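(* Let $(X_n,T_n)_{n\in\mathbb{N}_0}$ be a non-stationary full shift with potentials $\varphi_n:X_n\to(0,\infty)$, and let $r\in(0,1)$ be fixed. Assume that $\sup_{n\in\mathbb{N}_0}D_r(\log\varphi_n)<\infty$ and that $\|\mathbb{L}_n(\mathbf{1})\|_\infty<\infty$ for all $n\in\mathbb{N}_0$. Then there exist $C>1$ and $s\in(0,1)$ such that for all $n\in\mathbb{N}_0$, all $f\in\mathcal{H}^{loc}_n$ and all $k\in\mathbb{N}$: (1) $D(\mathbb{P}_n^k(f))\leqslant Cs^k\left(\|f\|_{n,1}+\|\mathcal{D}_r(f)\|_{n,1}\right)$; (2) $\left\|\mathbb{P}_n^k(f)-\int f\,d\nu_n\,\mathbf{1}\right\|_\infty\leqslant Cs^k\left(\|f\|_{n,1}+\|\mathcal{D}_r(f)\|_{n,1}\right)$.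
   Context: Here $\mathbb{N}=\{1,2,\ldots\}$ and $\mathbb{N}_0=\mathbb{N}\cup\{0\}$. Non-stationary full shift: for each $n\in\mathbb{N}_0$ let $\mathcal{W}_n$ be a nonempty subset of $\mathbb{N}$. Put $X_n:=\{(x_n,x_{n+1},\ldots): x_i\in\mathcal{W}_i\ \forall i\geqslant n\}$ and $T_n:X_n\to X_{n+1}$, $(x_n,x_{n+1},\ldots)\mapsto(x_{n+1},x_{n+2},\ldots)$. Let $\mathcal{W}_n^k:=\{(x_n,\ldots,x_{n+k-1}):x_i\in\mathcal{W}_i\}$; for $w\in\mathcal{W}_n^k$, the cylinder $[w]\subset X_n$ is the set of sequences in $X_n$ whose first $k$ entries form $w$. $\mathcal{F}_n$ is the $\sigma$-algebra generated by all cylinders in $X_n$. For $w\in\mathcal{W}_n^k$, $\tau_w:X_{n+k}\to[w]$ is the map prepending $w$. Metric and Hölder functions: $d_r(x,y):=r^{\min\{i\geqslant 0:\ x_{n+i}\neq y_{n+i}\}}$ for $x\ne y$ in $X_n$, $d_r(x,x)=0$. For $f:X_n\to\mathbb{R}$, $D_r(f):=\sup\{|f(x)-f(y)|/r^k: x,y\in[w],\ w\in\mathcal{W}_n^k,\ k=1,2,\ldots\}$, and $D(f):=\sup\{|f(x)-f(y)|/d_r(x,y):x\neq y\in X_n\}$. $\mathcal{H}^r_n:=\{f:X_n\to\mathbb{R}:\ \|f\|_\infty+D_r(f)<\infty\}$. Operators: $\mathbb{L}_n(f)(x):=\sum_{w\in\mathcal{W}_n}\varphi_n(\tau_w(x))f(\tau_w(x))$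 for $x\in X_{n+1}$ and $f:X_n\to\mathbb{R}$ (whenever the series makes sense), $\mathbb{L}_n^k:=\mathbb{L}_{n+k-1}\circ\cdots\circ\mathbb{L}_n$ ($\mathbb{L}_n^0$ is the identity), and $\mathbb{P}_n^k(f):=\mathbb{L}_n^k(f\cdot\mathbb{L}_0^n(\mathbf{1}))/\mathbb{L}_0^{n+k}(\mathbf{1})$, a function on $X_{n+k}$; for $f\in\mathcal{H}^{loc}_n$ (defined below) and $k\geqslant1$ the defining series converges absolutely. Measures: under the stated assumptions there is a unique sequence of Borel probability measures $\nu_n$ on $(X_n,\mathcal{F}_n)$ with $\int f\,d\nu_n=\lim_{k\to\infty}\mathbb{P}_n^k(f)(x_k)$ for every $f\in\mathcal{H}_n^r$ and every sequence $(x_k)$ with $x_k\in X_{n+k}$; one has $(\mathbb{P}_n^k)^*\nu_{n+k}=\nu_n$. These are the $\nu_n$ in the claim, and it is known that there are $C\geqslant 1$, $s\in(0,1)$ such that $D(\mathbb{P}_n^k(f))\leqslant Cs^kD(f)$ and $\|\mathbb{P}_n^k(f)-\int f\,d\nu_n\mathbf{1}\|_\infty\leqslant Cs^kD(f)$ for all $n,k\in\mathbb{N}_0$, $f\in\mathcal{H}^r_n$. Local Hölder spaces: for $f:X_n\to\mathbb{R}$, $\mathcal{D}_r(f):X_n\to[0,\infty]$ is constant on cylinders of length $1$ and for $x\in[a]$, $a\in\mathcal{W}_n^1$, $\mathcal{D}_r(f)(x):=\sup\{|f(y_1)-f(y_2)|/r^k:\ y_1,y_2\in[a]\cap[w],\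 w\in\mathcal{W}_n^k,\ k=1,2,\ldots\}$. $\|f\|_{n,p}:=(\int|f|^pd\nu_n)^{1/p}$ and $\mathcal{H}^{loc}_n:=\{f:X_n\to\mathbb{R}:\ \|f\|_{n,1}<\infty,\ \|\mathcal{D}_r(f)\|_{n,1}<\infty\}$. *)

theory Defs
  imports "HOL-Probability.Probability" "HOL-Library.Stream"
begin

(* The alphabets are W 0, W 1, ..., and a point (x_n, x_{n+1}, ...) of X_n is stored as a stream
   whose entry number i is x_{n+i}.  In this encoding T_n is stl, and the branch tau_w is
   x |-> w @- x (a ## x for a single letter a).  A function on X_n is a function on all streams;
   every notion below only looks at its values on X_n. *)

definition shift_space :: "(nat \<Rightarrow> nat set) \<Rightarrow> nat \<Rightarrow> nat stream set" where
  "shift_space W n = {x. \<forall>i. x !! i \<in> W (n + i)}"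

definition words :: "(nat \<Rightarrow> nat set) \<Rightarrow> nat \<Rightarrow> nat \<Rightarrow> nat list set" where
  "words W n k = {w. length w = k \<and> (\<forall>i<k. w ! i \<in> W (n + i))}"

definition cylinder :: "(nat \<Rightarrow> nat set) \<Rightarrow> nat \<Rightarrow> nat list \<Rightarrow> nat stream set" where
  "cylinder W n w = {x \<in> shift_space W n. stake (length w) x = w}"

definition cylinder_algebra :: "(nat \<Rightarrow> nat set) \<Rightarrow> nat \<Rightarrow> nat stream measure" where
  "cylinder_algebra W n =
     sigma (shift_space W n) {cylinder W n w | w k. w \<in> words W n k}"

definition shift_dist :: "real \<Rightarrow> nat stream \<Rightarrow> nat stream \<Rightarrow> real" where
  "shift_dist r x y = (if x = y then 0 else r ^ (LEAST i. x !! i \<noteq> y !! i))"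

(* D_r(f): only pairs in a common cylinder of length at least 1 are compared. *)
definition holder_const ::
    "real \<Rightarrow> (nat \<Rightarrow> nat set) \<Rightarrow> nat \<Rightarrow> (nat stream \<Rightarrow> real) \<Rightarrow> ennreal" where
  "holder_const r W n f =
     Sup {ennreal (\<bar>f x - f y\<bar> / r ^ k) | x y w k.
            k \<ge> 1 \<and> w \<in> words W n k \<and> x \<in> cylinder W n w \<and> y \<in> cylinder W n w}"

(* D(f): the Lipschitz constant of f on (X_n, d_r), comparing arbitrary pairs. *)
definition lip_const ::
    "real \<Rightarrow> (nat \<Rightarrow> nat set) \<Rightarrow> nat \<Rightarrow> (nat stream \<Rightarrow> real) \<Rightarrow> ennreal" where
  "lip_const r W n f =
     Sup {ennreal (\<bar>f x - f y\<bar> / shift_dist r x y) | x y.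
            x \<in> shift_space W n \<and> y \<in> shift_space W n \<and> x \<noteq> y}"

definition sup_norm :: "(nat \<Rightarrow> nat set) \<Rightarrow> nat \<Rightarrow> (nat stream \<Rightarrow> real) \<Rightarrow> ennreal" where
  "sup_norm W n f = (SUP x\<in>shift_space W n. ennreal \<bar>f x\<bar>)"

definition holder_space ::
    "real \<Rightarrow> (nat \<Rightarrow> nat set) \<Rightarrow> nat \<Rightarrow> (nat stream \<Rightarrow> real) set" where
  "holder_space r W n = {f. sup_norm W n f + holder_const r W n f < \<infinity>}"

(* The function \<D>_r(f), with values in [0, \<infinity>]; its 1-cylinder at x is [shd x]. *)
definition local_holder_const ::
    "real \<Rightarrow> (nat \<Rightarrow> nat set) \<Rightarrow> nat \<Rightarrow> (nat stream \<Rightarrow> real) \<Rightarrow> nat stream \<Rightarrow> ennreal" where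
  "local_holder_const r W n f x =
     Sup {ennreal (\<bar>f y1 - f y2\<bar> / r ^ k) | y1 y2 w k.
            k \<ge> 1 \<and> w \<in> words W n k \<and>
            y1 \<in> cylinder W n [shd x] \<inter> cylinder W n w \<and>
            y2 \<in> cylinder W n [shd x] \<inter> cylinder W n w}"

(* infsum is 0 for a divergent series; for real summands convergence on a set is absolute
   convergence. *)
definition transfer_op ::
    "(nat \<Rightarrow> nat set) \<Rightarrow> (nat \<Rightarrow> nat stream \<Rightarrow> real) \<Rightarrow> nat
      \<Rightarrow> (nat stream \<Rightarrow> real) \<Rightarrow> nat stream \<Rightarrow> real" where
  "transfer_op W \<phi> n f x = (\<Sum>\<^sub>\<infinity>a\<in>W n. \<phi> n (a ## x) * f (a ## x))"

primrec transfer_iter ::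
    "(nat \<Rightarrow> nat set) \<Rightarrow> (nat \<Rightarrow> nat stream \<Rightarrow> real) \<Rightarrow> nat \<Rightarrow> nat
      \<Rightarrow> (nat stream \<Rightarrow> real) \<Rightarrow> nat stream \<Rightarrow> real" where
  "transfer_iter W \<phi> n 0 f = f"
| "transfer_iter W \<phi> n (Suc k) f = transfer_op W \<phi> (n + k) (transfer_iter W \<phi> n k f)"

(* P_n^k(f), a function on X_{n+k} *)
definition normalized_op ::
    "(nat \<Rightarrow> nat set) \<Rightarrow> (nat \<Rightarrow> nat stream \<Rightarrow> real) \<Rightarrow> nat \<Rightarrow> nat
      \<Rightarrow> (nat stream \<Rightarrow> real) \<Rightarrow> nat stream \<Rightarrow> real" where
  "normalized_op W \<phi> n k f x =
     transfer_iter W \<phi> n k (\<lambda>y. f y * transfer_iter W \<phi> 0 n (\<lambda>_. 1) y) x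
       / transfer_iter W \<phi> 0 (n + k) (\<lambda>_. 1) x"

(* The characterization of the unique sequence (\<nu>_n). *)
definition limit_measures ::
    "real \<Rightarrow> (nat \<Rightarrow> nat set) \<Rightarrow> (nat \<Rightarrow> nat stream \<Rightarrow> real)
      \<Rightarrow> (nat \<Rightarrow> nat stream measure) \<Rightarrow> bool" where
  "limit_measures r W \<phi> \<nu> \<longleftrightarrow>
     (\<forall>n. prob_space (\<nu> n) \<and> sets (\<nu> n) = sets (cylinder_algebra W n) \<and>
        (\<forall>f\<in>holder_space r W n. \<forall>x. (\<forall>k. x k \<in> shift_space W (n + k)) \<longrightarrow>
           (\<lambda>k. normalized_op W \<phi> n k f (x k)) \<longlonglongrightarrow> (\<integral>y. f y \<partial>\<nu> n)))"

definition local_holder_norm ::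
    "real \<Rightarrow> (nat \<Rightarrow> nat set) \<Rightarrow> (nat \<Rightarrow> nat stream measure) \<Rightarrow> nat
      \<Rightarrow> (nat stream \<Rightarrow> real) \<Rightarrow> ennreal" where
  "local_holder_norm r W \<nu> n f =
     (\<integral>\<^sup>+x. ennreal \<bar>f x\<bar> \<partial>\<nu> n) + (\<integral>\<^sup>+x. local_holder_const r W n f x \<partial>\<nu> n)"

(* Measurability of f is not required separately: 1-cylinders have positive \<nu>_n-measure, so
   finiteness of the second integral makes f Hoelder on each of them. *)
definition local_holder_space ::
    "real \<Rightarrow> (nat \<Rightarrow> nat set) \<Rightarrow> (nat \<Rightarrow> nat stream measure) \<Rightarrow> nat
      \<Rightarrow> (nat stream \<Rightarrow> real) set" where
  "local_holder_space r W \<nu> n =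
     {f. (\<integral>\<^sup>+x. ennreal \<bar>f x\<bar> \<partial>\<nu> n) < \<infinity> \<and>
         (\<integral>\<^sup>+x. local_holder_const r W n f x \<partial>\<nu> n) < \<infinity>}"

end

(* Put h_n := L_0^n(1) and g_n(a, x) := phi_n(ax) h_n(ax) / h_{n+1}(x).  Then sum_a g_n(a, x) = 1 and
   P_n^{k+1} f (x) = sum_a g_{n+k}(a, x) P_n^k f (ax), so P is a composition of averaging operators
   whose weights satisfy g_n(a, x) <= exp(2 L d(x, y)) g_n(a, y).  Coupling the weights at x and y shows
   that one averaging step contracts, by a fixed factor < 1, the Lipschitz constant with respect to the
   concave modulus 1 - exp(-kappa t) + c t, which is comparable with t.

   Testing nu_n on indicators gives g_n(a, x) <= exp(2 L) nu_n[a].  Hence the first step P_n^1 already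
   maps a locally Hoelder function to a Lipschitz function whose constant is controlled by the local
   norm, and the contraction gives (1).  The oscillation of P_n^k f bounds its distance to all later
   P_n^{k+j} f; their limit is the integral of f, because f is approximated by its truncations to
   finitely many first letters, which are Hoelder, uniformly after one step. *)

theory Submission
  imports Defs
begin

subsection \<open>Shift spaces and Hoelder constants\<close>

lemma SCons_in_shift_space [simp]:
  "a ## x \<in> shift_space W n \<longleftrightarrow> a \<in> W n \<and> x \<in> shift_space W (Suc n)"
proof -
  have "(\<forall>i. (a ## x) !! i \<in> W (n + i)) \<longleftrightarrow> a \<in> W n \<and> (\<forall>i. x !! i \<in> W (Suc n + i))"
    (is "?l \<longleftrightarrow> ?r")
  proof
    assume l: ?l
    show ?r using l[rule_format, of 0] l[rule_format, of "Suc _"] by simp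
  next
    assume r: ?r
    show ?l
    proof
      show "(a ## x) !! i \<in> W (n + i)" for i using r by (cases i) auto
    qed
  qed
  then show ?thesis by (simp add: shift_space_def)
qed

lemma shd_in_alphabet: "x \<in> shift_space W n \<Longrightarrow> shd x \<in> W n"
  by (metis SCons_in_shift_space stream.collapse)

lemma shift_space_SConsE:
  assumes "x \<in> shift_space W n"
  obtains a x' where "x = a ## x'" "a \<in> W n" "x' \<in> shift_space W (Suc n)"
  by (metis SCons_in_shift_space stream.collapse assms)

lemma shift_space_nonempty:
  assumes "\<And>n. W n \<noteq> {}"
  shows "\<exists>x. x \<in> shift_space W n"
proof -
  have "\<forall>i. \<exists>a. a \<in> W (n + i)" using assms by blast
  then obtain c where "\<And>i. c i \<in> W (n + i)" by metis
  then have "smap c (fromN 0) \<in> shift_space W n" by (simp add: shift_space_def)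
  then show ?thesis ..
qed

lemma stream_neq_snth: "x \<noteq> y \<Longrightarrow> \<exists>i. x !! i \<noteq> y !! i"
proof (rule ccontr)
  assume "x \<noteq> y" "\<nexists>i. x !! i \<noteq> y !! i"
  then have "snth x = snth y" by auto
  then have "smap (snth x) nats = smap (snth y) nats" by simp
  then have "x = y" by (simp only: stream_smap_nats[symmetric])
  with \<open>x \<noteq> y\<close> show False by contradiction
qed

lemma shift_dist_SCons [simp]: "shift_dist r (a ## x) (a ## y) = r * shift_dist r x y"
proof (cases "x = y")
  case False
  then obtain i where "x !! i \<noteq> y !! i" using stream_neq_snth by blast
  then have "(LEAST i. (a ## x) !! i \<noteq> (a ## y) !! i) = Suc (LEAST i. x !! i \<noteq> y !! i)"
    using Least_Suc[of "\<lambda>i. (a ## x) !! i \<noteq> (a ## y) !! i" "Suc i"] by simp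
  with False show ?thesis by (simp add: shift_dist_def)
qed (simp add: shift_dist_def)

lemma shift_dist_self [simp]: "shift_dist r x x = 0"
  by (simp add: shift_dist_def)

lemma shift_dist_commute: "shift_dist r x y = shift_dist r y x"
  by (simp add: shift_dist_def eq_commute)

lemma shift_dist_nonneg: "0 < r \<Longrightarrow> 0 \<le> shift_dist r x y"
  by (simp add: shift_dist_def)

lemma shift_dist_pos: "0 < r \<Longrightarrow> x \<noteq> y \<Longrightarrow> 0 < shift_dist r x y"
  by (simp add: shift_dist_def)

lemma shift_dist_le_1: "0 < r \<Longrightarrow> r < 1 \<Longrightarrow> shift_dist r x y \<le> 1"
  by (simp add: shift_dist_def power_le_one)

lemma stake_in_words: "x \<in> shift_space W n \<Longrightarrow> stake k x \<in> words W n k"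
  by (simp add: words_def shift_space_def)

text \<open>The longest common prefix works: its length is the first index of disagreement, which is
  positive because the heads agree. This links quotients over cylinders with the metric.\<close>

lemma common_cylinder:
  assumes "x \<in> shift_space W n" "y \<in> shift_space W n" "x \<noteq> y" "shd x = shd y"
  obtains k w where "k \<ge> 1" "w \<in> words W n k" "x \<in> cylinder W n w" "y \<in> cylinder W n w"
    "shift_dist r x y = r ^ k"
proof -
  define k where "k = (LEAST i. x !! i \<noteq> y !! i)"
  have neq: "x !! k \<noteq> y !! k"
    unfolding k_def using stream_neq_snth[OF \<open>x \<noteq> y\<close>] by (rule LeastI_ex)
  have "k \<noteq> 0" using neq assms(4) by (metis snth.simps(1))
  moreover have "stake k x = stake k y"
    by (rule nth_equalityI) (auto simp: k_def dest: not_less_Least)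
  ultimately show thesis
    using assms stake_in_words[OF assms(1), of k]
    by (intro that[of k "stake k x"]) (auto simp: cylinder_def shift_dist_def k_def)
qed

text \<open>Testing the supremum on the longest common prefix turns it into a Lipschitz estimate
  inside each 1-cylinder.\<close>

lemma holder_const_bound:
  assumes "holder_const r W n f \<le> ennreal H" "0 < r" "0 \<le> H"
    and "x \<in> shift_space W n" "y \<in> shift_space W n" "shd x = shd y"
  shows "\<bar>f x - f y\<bar> \<le> H * shift_dist r x y"
proof (cases "x = y")
  case False
  obtain k w where kw: "k \<ge> 1" "w \<in> words W n k" "x \<in> cylinder W n w" "y \<in> cylinder W n w"
    "shift_dist r x y = r ^ k"
    using common_cylinder[OF assms(4,5) False assms(6)] by metis
  have "ennreal (\<bar>f x - f y\<bar> / r ^ k) \<le> holder_const r W n f"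
    unfolding holder_const_def using kw by (intro Sup_upper) auto
  also note assms(1)
  finally have "\<bar>f x - f y\<bar> / r ^ k \<le> H" using assms by simp
  then show ?thesis using kw assms by (simp add: field_simps)
qed simp

lemma local_holder_const_bound:
  assumes "local_holder_const r W n f z \<le> ennreal H" "0 < r" "0 \<le> H"
    and "x \<in> shift_space W n" "y \<in> shift_space W n" "shd x = shd z" "shd y = shd z"
  shows "\<bar>f x - f y\<bar> \<le> H * shift_dist r x y"
proof (cases "x = y")
  case False
  obtain k w where kw: "k \<ge> 1" "w \<in> words W n k" "x \<in> cylinder W n w" "y \<in> cylinder W n w"
    "shift_dist r x y = r ^ k"
    using common_cylinder[OF assms(4,5) False] assms(6,7) by metis
  have "ennreal (\<bar>f x - f y\<bar> / r ^ k) \<le> local_holder_const r W n f z"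
    unfolding local_holder_const_def using kw assms by (intro Sup_upper) (force simp: cylinder_def)
  also note assms(1)
  finally have "\<bar>f x - f y\<bar> / r ^ k \<le> H" using assms by simp
  then show ?thesis using kw assms by (simp add: field_simps)
qed simp

subsection \<open>Weighted averages and coupling\<close>

lemma has_sum_diff:
  fixes f g :: "'a \<Rightarrow> 'b::{topological_ab_group_add, t2_space}"
  assumes "(f has_sum a) I" "(g has_sum b) I"
  shows "((\<lambda>x. f x - g x) has_sum (a - b)) I"
  using has_sum_add[OF assms(1), of "\<lambda>x. - g x" "- b"] assms(2) by (simp add: has_sum_uminus)

lemma infsum_diff:
  fixes f g :: "'a \<Rightarrow> 'b::{topological_ab_group_add, t2_space}"
  assumes "f summable_on I" "g summable_on I"
  shows "(\<Sum>\<^sub>\<infinity>x\<in>I. f x - g x) = infsum f I - infsum g I"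
  using assms by (intro infsumI has_sum_diff has_sum_infsum)

lemma summable_on_mult_bounded:
  fixes p u :: "'a \<Rightarrow> real"
  assumes "p summable_on I" "\<And>a. a \<in> I \<Longrightarrow> 0 \<le> p a" "\<And>a. a \<in> I \<Longrightarrow> \<bar>u a\<bar> \<le> B"
  shows "(\<lambda>a. p a * u a) summable_on I"
proof (rule summable_on_iff_abs_summable_on_real[THEN iffD2, OF Infinite_Sum.abs_summable_on_comparison_test'])
  show "(\<lambda>a. p a * B) summable_on I" using assms(1) by (rule summable_on_cmult_left)
  show "norm (p a * u a) \<le> p a * B" if "a \<in> I" for a
    using assms(2,3)[OF that] by (simp add: abs_mult mult_left_mono)
qed

text \<open>The bound \<open>B\<close> secures summability, without which \<open>infsum\<close>
  would default to 0. The mass \<open>m\<close> is general because \<open>coupling_le\<close>,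
  through \<open>average_ge\<close>, also averages with residual weights of mass 1 - e.\<close>

lemma average_le:
  fixes p u :: "'a \<Rightarrow> real"
  assumes "(p has_sum m) I" "\<And>a. a \<in> I \<Longrightarrow> 0 \<le> p a"
    and "\<And>a. a \<in> I \<Longrightarrow> \<bar>u a\<bar> \<le> B" "\<And>a. a \<in> I \<Longrightarrow> u a \<le> t"
  shows "(\<Sum>\<^sub>\<infinity>a\<in>I. p a * u a) \<le> m * t"
proof -
  have s: "p summable_on I" using assms(1) by (rule has_sum_imp_summable)
  have "(\<Sum>\<^sub>\<infinity>a\<in>I. p a * u a) \<le> (\<Sum>\<^sub>\<infinity>a\<in>I. p a * t)"
    using assms by (intro infsum_mono summable_on_mult_bounded[OF s, of _ B] summable_on_cmult_left s)
      (auto intro: mult_left_mono)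
  also have "\<dots> = m * t" using assms(1) by (simp add: infsum_cmult_left' infsumI)
  finally show ?thesis .
qed

lemma average_ge:
  fixes p u :: "'a \<Rightarrow> real"
  assumes "(p has_sum m) I" "\<And>a. a \<in> I \<Longrightarrow> 0 \<le> p a"
    and "\<And>a. a \<in> I \<Longrightarrow> \<bar>u a\<bar> \<le> B" "\<And>a. a \<in> I \<Longrightarrow> t \<le> u a"
  shows "m * t \<le> (\<Sum>\<^sub>\<infinity>a\<in>I. p a * u a)"
  using average_le[OF assms(1), of "\<lambda>a. - u a" B "- t"] assms by (simp add: infsum_uminus)

text \<open>Both weights contain the common part e p; only the rest, of mass 1 - e, sees the oscillation \<open>\<beta>\<close>.\<close>

lemma coupling_le:
  fixes p q u v :: "'a \<Rightarrow> real"
  assumes p: "(p has_sum 1) I" "\<And>a. a \<in> I \<Longrightarrow> 0 \<le> p a"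
    and q: "(q has_sum 1) I" "\<And>a. a \<in> I \<Longrightarrow> e * p a \<le> q a"
    and e: "0 \<le> e" "e \<le> 1"
    and B: "\<And>a. a \<in> I \<Longrightarrow> \<bar>u a\<bar> \<le> B" "\<And>a. a \<in> I \<Longrightarrow> \<bar>v a\<bar> \<le> B"
    and close: "\<And>a. a \<in> I \<Longrightarrow> u a - v a \<le> \<alpha>"
    and osc: "\<And>a b. a \<in> I \<Longrightarrow> b \<in> I \<Longrightarrow> u a - v b \<le> \<beta>"
  shows "(\<Sum>\<^sub>\<infinity>a\<in>I. p a * u a) - (\<Sum>\<^sub>\<infinity>a\<in>I. q a * v a) \<le> e * \<alpha> + (1 - e) * \<beta>"
proof -
  let ?S = "\<lambda>p u. \<Sum>\<^sub>\<infinity>a\<in>I. p a * u a"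
  have sp: "p summable_on I" using p(1) by (rule has_sum_imp_summable)
  have q0: "0 \<le> q a" if "a \<in> I" for a
    using q(2)[OF that] p(2)[OF that] e(1) by (meson mult_nonneg_nonneg order_trans)
  have sq: "q summable_on I" using q(1) by (rule has_sum_imp_summable)
  have spu: "(\<lambda>a. p a * u a) summable_on I" and spv: "(\<lambda>a. p a * v a) summable_on I"
    and sqv: "(\<lambda>a. q a * v a) summable_on I"
    using p(2) q0 B by (auto intro!: summable_on_mult_bounded[where B=B] sp sq)
  have 1: "?S p u - ?S p v \<le> \<alpha>"
  proof -
    have "\<bar>u a - v a\<bar> \<le> B + B" if "a \<in> I" for a using B[OF that] by linarith
    then have "?S p (\<lambda>a. u a - v a) \<le> 1 * \<alpha>" using p close by (intro average_le) auto
    then show ?thesis using infsum_diff[OF spu spv] by (simp add: right_diff_distrib)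
  qed
  \<comment> \<open>Averaging the oscillation bound over the first argument turns it into one lower
    bound for all values of v.\<close>
  have 2: "?S p u - \<beta> \<le> v b" if "b \<in> I" for b
  proof -
    have "?S p u \<le> 1 * (v b + \<beta>)"
      using p B osc[OF _ that] by (intro average_le) (auto simp: algebra_simps)
    then show ?thesis by simp
  qed
  \<comment> \<open>The residual weights are nonnegative with total mass 1 - e, so the lower bound 2
    can be averaged against them.\<close>
  have "((\<lambda>a. q a - e * p a) has_sum (1 - e * 1)) I"
    using p q by (intro has_sum_diff has_sum_cmult_right) auto
  then have "(1 - e) * (?S p u - \<beta>) \<le> ?S (\<lambda>a. q a - e * p a) v"
    using q B 2 by (intro average_ge) auto
  also have "\<dots> = ?S q v - e * ?S p v"
    using infsum_diff[OF sqv summable_on_cmult_right[OF spv, of e]]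
    by (simp add: left_diff_distrib mult.assoc infsum_cmult_right')
  finally show ?thesis
    using mult_left_mono[OF 1 e(1)] by (simp add: algebra_simps)
qed

subsection \<open>Normalized transfer operators\<close>

text \<open>\<open>M\<close> bounds the Hoelder constants of all log-potentials at once.
  \<open>phi_ratio\<close> is that bound after exponentiation; its factor \<open>r\<close> appears
  because prepending a letter shrinks distances by \<open>r\<close>.\<close>

locale holder_shift =
  fixes W :: "nat \<Rightarrow> nat set" and \<phi> :: "nat \<Rightarrow> nat stream \<Rightarrow> real" and r M :: real
  assumes W_nonempty: "\<And>n. W n \<noteq> {}"
    and phi_pos: "\<And>n x. x \<in> shift_space W n \<Longrightarrow> 0 < \<phi> n x"
    and r_pos: "0 < r" and r_less_1: "r < 1" and M_nonneg: "0 \<le> M"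
    and phi_ratio: "\<And>n a x y. a \<in> W n \<Longrightarrow> x \<in> shift_space W (Suc n) \<Longrightarrow> y \<in> shift_space W (Suc n) \<Longrightarrow>
      \<phi> n (a ## x) \<le> exp (M * r * shift_dist r x y) * \<phi> n (a ## y)"
    and phi_summable: "\<And>n x. x \<in> shift_space W (Suc n) \<Longrightarrow> (\<lambda>a. \<phi> n (a ## x)) summable_on W n"
begin

abbreviation "X \<equiv> shift_space W"
abbreviation "d \<equiv> shift_dist r"
abbreviation "P \<equiv> normalized_op W \<phi>"

section \<open>Densities, transition weights and the constants of the contraction\<close>

definition h :: "nat \<Rightarrow> nat stream \<Rightarrow> real" where
  "h n = transfer_iter W \<phi> 0 n (\<lambda>_. 1)"

definition g :: "nat \<Rightarrow> nat \<Rightarrow> nat stream \<Rightarrow> real" where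
  "g n a x = \<phi> n (a ## x) * h n (a ## x) / h (Suc n) x"

text \<open>The geometric series of \<open>M * r ^ i\<close> over i from 1 on, hence the solution of
  L = M r + L r; it is a log-Lipschitz constant for every \<open>h n\<close>.\<close>

definition L :: real where "L = M * r / (1 - r)"

text \<open>The solution of \<kappa> = 2 L + \<kappa> r, where 2 L is the log-Lipschitz constant of
  the weights \<open>g\<close>.\<close>

definition \<kappa> :: real where "\<kappa> = 2 * L / (1 - r)"

text \<open>Chosen so that \<open>modulus 1\<close> equals 1, which lets the constants cancel in the
  coupling estimate.\<close>

definition c :: real where "c = exp (- \<kappa>)"

text \<open>The average of 1 and \<open>r\<close> with weights \<open>\<kappa>\<close> and
  \<open>c\<close>: the exponential part of the modulus is kept, its linear part shrinks by
  \<open>r\<close>.\<close>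

definition rate :: real where "rate = (\<kappa> + c * r) / (\<kappa> + c)"

definition modulus :: "real \<Rightarrow> real" where "modulus t = 1 - exp (- \<kappa> * t) + c * t"

lemma d_bounds [simp]: "0 \<le> d x y" "d x y \<le> 1"
  using r_pos r_less_1 by (simp_all add: shift_dist_nonneg shift_dist_le_1)

lemma L_nonneg: "0 \<le> L" and kappa_nonneg: "0 \<le> \<kappa>" and c_pos: "0 < c"
  using r_pos r_less_1 M_nonneg by (simp_all add: L_def \<kappa>_def c_def)

lemma L_fixed: "M * r + L * r = L"
  using r_less_1 by (simp add: L_def field_simps)

lemma kappa_fixed: "2 * L + \<kappa> * r = \<kappa>"
  using r_less_1 by (simp add: \<kappa>_def field_simps)

lemma rate_pos: "0 < rate" and rate_less_1: "rate < 1"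
  using r_pos r_less_1 kappa_nonneg c_pos by (simp_all add: rate_def add_nonneg_pos)

lemma modulus_ge: "0 \<le> t \<Longrightarrow> c * t \<le> modulus t"
  using kappa_nonneg by (simp add: modulus_def)

lemma modulus_le: "modulus t \<le> (\<kappa> + c) * t"
  using exp_ge_add_one_self[of "- \<kappa> * t"] by (simp add: modulus_def algebra_simps)

lemma modulus_mono: "t \<le> u \<Longrightarrow> modulus t \<le> modulus u"
  using kappa_nonneg c_pos
  by (auto simp: modulus_def intro!: add_mono mult_left_mono diff_mono)

text \<open>The choice of the modulus makes the term \<open>1 - exp (- \<kappa> t)\<close> exactly invariant under the
  coupling estimate, while its linear part is contracted by the factor r.\<close>

lemma modulus_contraction:
  assumes "0 \<le> t"
  shows "exp (- (2 * L * t)) * modulus (r * t) + (1 - exp (- (2 * L * t))) * modulus 1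
    \<le> rate * modulus t"
proof -
  let ?e = "exp (- (2 * L * t))" and ?u = "1 - exp (- \<kappa> * t)"
  have "- (2 * L * t) + - \<kappa> * (r * t) = - (2 * L + \<kappa> * r) * t" by (simp add: algebra_simps)
  then have e: "?e * exp (- \<kappa> * (r * t)) = exp (- \<kappa> * t)"
    by (simp add: kappa_fixed flip: exp_add)
  have "?e * modulus (r * t) + (1 - ?e) * modulus 1 = ?u + ?e * (c * r * t)"
    unfolding modulus_def using e by (simp add: c_def algebra_simps)
  also have "\<dots> \<le> ?u + 1 * (c * r * t)"
    using L_nonneg assms c_pos r_pos by (intro add_left_mono mult_right_mono) auto
  also have "\<dots> \<le> rate * modulus t"
  proof -
    \<comment> \<open>Once the denominator of \<open>rate\<close> is cleared, the claim is this
      bound multiplied by c (1 - r).\<close>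
    have "?u \<le> \<kappa> * t" using exp_ge_add_one_self[of "- \<kappa> * t"] by simp
    then have "(c * (1 - r)) * ?u \<le> (c * (1 - r)) * (\<kappa> * t)"
      using c_pos r_less_1 by (intro mult_left_mono) auto
    then have "(?u + c * r * t) * (\<kappa> + c) \<le> (\<kappa> + c * r) * (?u + c * t)"
      by (simp add: algebra_simps)
    then show ?thesis
      using c_pos kappa_nonneg by (simp add: rate_def modulus_def field_simps)
  qed
  finally show ?thesis .
qed

section \<open>Positivity and distortion of the densities, and the averaging form of the
  operators\<close>

lemma h_Suc: "h (Suc n) x = (\<Sum>\<^sub>\<infinity>a\<in>W n. \<phi> n (a ## x) * h n (a ## x))"
  by (simp add: h_def transfer_op_def)

lemma h_0: "h 0 x = 1"
  by (simp add: h_def)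

text \<open>Bounded distortion makes \<open>h n\<close> bounded by a multiple of its value at one
  point. The facts on \<open>h n\<close> are premises because the lemma is applied inside the
  induction that establishes them.\<close>

lemma phi_h_summable:
  assumes "x \<in> X (Suc n)" "\<And>x. x \<in> X n \<Longrightarrow> 0 < h n x"
    and "\<And>x y. x \<in> X n \<Longrightarrow> y \<in> X n \<Longrightarrow> h n x \<le> exp (L * d x y) * h n y"
  shows "(\<lambda>a. \<phi> n (a ## x) * h n (a ## x)) summable_on W n"
proof -
  obtain z where z: "z \<in> X n" using shift_space_nonempty W_nonempty by metis
  have "\<bar>h n y\<bar> \<le> exp L * h n z" if y: "y \<in> X n" for y
  proof -
    have "L * d y z \<le> L" using L_nonneg by (simp add: mult_left_le)
    then have "exp (L * d y z) * h n z \<le> exp L * h n z"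
      using assms(2)[OF z] by (intro mult_right_mono) auto
    with assms(2)[OF y] assms(3)[OF y z] show ?thesis by simp
  qed
  then show ?thesis
    using assms(1) phi_pos
    by (intro summable_on_mult_bounded[of _ _ _ "exp L * h n z"] phi_summable)
      (auto simp: less_imp_le)
qed

text \<open>Both claims go through one induction, since the series for \<open>h (Suc n)\<close>
  converges by both of them at level n. In each term \<open>\<phi>\<close> contributes the exponent
  M r and \<open>h n\<close> the exponent L r, which add up to L.\<close>

lemma h_pos_ratio:
  "(\<forall>x\<in>X n. 0 < h n x) \<and> (\<forall>x\<in>X n. \<forall>y\<in>X n. h n x \<le> exp (L * d x y) * h n y)"
proof (induction n)
  case 0
  show ?case using L_nonneg by (simp add: h_0)
next
  case (Suc n)
  have sum: "(\<lambda>a. \<phi> n (a ## x) * h n (a ## x)) summable_on W n" if "x \<in> X (Suc n)" for x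
    using Suc that by (intro phi_h_summable) auto
  have pos: "0 < \<phi> n (a ## x) * h n (a ## x)" if "x \<in> X (Suc n)" "a \<in> W n" for a x
    using Suc that phi_pos by auto
  have "0 < h (Suc n) x" if x: "x \<in> X (Suc n)" for x
  proof -
    \<comment> \<open>A single positive term bounds the series from below.\<close>
    obtain a where a: "a \<in> W n" using W_nonempty by blast
    have "(\<Sum>\<^sub>\<infinity>a\<in>{a}. \<phi> n (a ## x) * h n (a ## x)) \<le> h (Suc n) x"
      unfolding h_Suc using a x pos
      by (intro infsum_mono_neutral sum) (auto simp: less_imp_le)
    then show ?thesis using pos[OF x a] by simp
  qed
  moreover have "h (Suc n) x \<le> exp (L * d x y) * h (Suc n) y"
    if x: "x \<in> X (Suc n)" and y: "y \<in> X (Suc n)" for x y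
  proof -
    have "\<phi> n (a ## x) * h n (a ## x) \<le> exp (L * d x y) * (\<phi> n (a ## y) * h n (a ## y))"
      if a: "a \<in> W n" for a
    proof -
      have "h n (a ## x) \<le> exp (L * d (a ## x) (a ## y)) * h n (a ## y)"
        using Suc a x y by (simp del: shift_dist_SCons)
      then have "\<phi> n (a ## x) * h n (a ## x)
          \<le> (exp (M * r * d x y) * \<phi> n (a ## y)) * (exp (L * d (a ## x) (a ## y)) * h n (a ## y))"
        using Suc a x y phi_pos[of "a ## x"] phi_pos[of "a ## y"]
        by (intro mult_mono phi_ratio) (auto simp: less_imp_le)
      also have "\<dots> = exp ((M * r + L * r) * d x y) * (\<phi> n (a ## y) * h n (a ## y))"
        by (simp add: exp_add algebra_simps)
      finally show ?thesis by (simp only: L_fixed)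
    qed
    then have "h (Suc n) x \<le> (\<Sum>\<^sub>\<infinity>a\<in>W n. exp (L * d x y) * (\<phi> n (a ## y) * h n (a ## y)))"
      unfolding h_Suc by (intro infsum_mono sum x summable_on_cmult_right y) auto
    also have "\<dots> = exp (L * d x y) * h (Suc n) y"
      unfolding h_Suc by (rule infsum_cmult_right')
    finally show ?thesis .
  qed
  ultimately show ?case by blast
qed

lemma h_pos: "x \<in> X n \<Longrightarrow> 0 < h n x"
  using h_pos_ratio by blast

lemma h_ratio: "x \<in> X n \<Longrightarrow> y \<in> X n \<Longrightarrow> h n x \<le> exp (L * d x y) * h n y"
  using h_pos_ratio by blast

lemma g_pos: "a \<in> W n \<Longrightarrow> x \<in> X (Suc n) \<Longrightarrow> 0 < g n a x"
  by (simp add: g_def h_pos phi_pos)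

lemma g_has_sum:
  assumes "x \<in> X (Suc n)"
  shows "((\<lambda>a. g n a x) has_sum 1) (W n)"
proof -
  have "((\<lambda>a. \<phi> n (a ## x) * h n (a ## x)) has_sum h (Suc n) x) (W n)"
    unfolding h_Suc using assms h_pos h_ratio by (intro has_sum_infsum phi_h_summable) auto
  from has_sum_cmult_left[OF this, of "1 / h (Suc n) x"] show ?thesis
    using h_pos[OF assms] by (simp add: g_def)
qed

text \<open>The numerator distorts by M r + L r = L in the exponent and the denominator by another
  L.\<close>

lemma g_ratio:
  assumes a: "a \<in> W n" and x: "x \<in> X (Suc n)" and y: "y \<in> X (Suc n)"
  shows "g n a x \<le> exp (2 * L * d x y) * g n a y"
proof -
  have "g n a x \<le> (exp (M * r * d x y) * \<phi> n (a ## y)) * (exp (L * d (a ## x) (a ## y)) * h n (a ## y))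
      / (exp (- (L * d x y)) * h (Suc n) y)"
    unfolding g_def
  proof (intro frac_le mult_mono phi_ratio h_ratio)
    \<comment> \<open>The lower bound on the denominator is \<open>h_ratio\<close> with the two
      points exchanged.\<close>
    show "exp (- (L * d x y)) * h (Suc n) y \<le> h (Suc n) x"
      using h_ratio[OF y x] by (simp add: exp_minus field_simps shift_dist_commute[of r y])
  qed (use assms phi_pos h_pos in \<open>auto simp: less_imp_le\<close>)
  also have "\<dots> = exp ((M * r + L * r + L) * d x y) * g n a y"
    by (simp add: g_def distrib_right exp_add exp_minus field_simps)
  finally show ?thesis by (simp add: L_fixed)
qed

lemma normalized_op_0: "x \<in> X n \<Longrightarrow> P n 0 f x = f x"
  using h_pos[of x n] by (simp add: normalized_op_def flip: h_def)

text \<open>The factor \<open>h (n + k) (a ## x)\<close> in the weight cancels the denominator of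
  the previous iterate, so one step is an average over the new first letter.\<close>

lemma normalized_op_Suc:
  assumes "x \<in> X (Suc (n + k))"
  shows "P n (Suc k) f x = (\<Sum>\<^sub>\<infinity>a\<in>W (n + k). g (n + k) a x * P n k f (a ## x))"
proof -
  let ?I = "transfer_iter W \<phi> n k (\<lambda>y. f y * h n y)"
  have P: "P n k f y = ?I y / h (n + k) y" for y
    by (simp add: normalized_op_def h_def)
  have "(\<Sum>\<^sub>\<infinity>a\<in>W (n + k). g (n + k) a x * P n k f (a ## x))
      = (\<Sum>\<^sub>\<infinity>a\<in>W (n + k). \<phi> (n + k) (a ## x) * ?I (a ## x) * (1 / h (Suc (n + k)) x))"
  proof (rule infsum_cong)
    fix a assume "a \<in> W (n + k)"
    then have "0 < h (n + k) (a ## x)" using assms by (simp add: h_pos)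
    then show "g (n + k) a x * P n k f (a ## x) = \<phi> (n + k) (a ## x) * ?I (a ## x) * (1 / h (Suc (n + k)) x)"
      by (simp add: g_def P)
  qed
  also have "\<dots> = P n (Suc k) f x"
    by (subst infsum_cmult_left') (simp add: normalized_op_def transfer_op_def h_def)
  finally show ?thesis by simp
qed

section \<open>Contraction of the modulus and the maximum principle\<close>

definition has_modulus :: "nat \<Rightarrow> real \<Rightarrow> (nat stream \<Rightarrow> real) \<Rightarrow> bool" where
  "has_modulus n A f \<longleftrightarrow> (\<forall>x\<in>X n. \<forall>y\<in>X n. \<bar>f x - f y\<bar> \<le> A * modulus (d x y))"

lemma has_modulus_bounded:
  assumes "has_modulus n A f" "0 \<le> A"
  obtains B where "\<And>x. x \<in> X n \<Longrightarrow> \<bar>f x\<bar> \<le> B"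
proof -
  obtain z where z: "z \<in> X n" using shift_space_nonempty W_nonempty by metis
  have "\<bar>f x\<bar> \<le> \<bar>f z\<bar> + A * modulus 1" if "x \<in> X n" for x
  proof -
    have "\<bar>f x - f z\<bar> \<le> A * modulus (d x z)" using assms that z by (auto simp: has_modulus_def)
    also have "\<dots> \<le> A * modulus 1" using assms by (intro mult_left_mono modulus_mono) auto
    finally show ?thesis by linarith
  qed
  then show thesis by (rule that)
qed

text \<open>The weights at two points share the proportion \<open>exp (- (2 * L * d x y))\<close>.
  On it equal letters are coupled, at distance r d(x, y); on the rest the points are at distance at
  most 1. \<open>modulus_contraction\<close> is made for exactly this sum.\<close>

lemma has_modulus_normalized_op_Suc:
  assumes f: "has_modulus (n + k) A (P n k f)" and A: "0 \<le> A"
  shows "has_modulus (n + Suc k) (rate * A) (P n (Suc k) f)"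
proof -
  obtain B where B: "\<And>x. x \<in> X (n + k) \<Longrightarrow> \<bar>P n k f x\<bar> \<le> B"
    using has_modulus_bounded[OF f A] by metis
  have one_sided: "P n (Suc k) f x - P n (Suc k) f y \<le> rate * A * modulus (d x y)"
    if x: "x \<in> X (Suc (n + k))" and y: "y \<in> X (Suc (n + k))" for x y
  proof -
    let ?e = "exp (- (2 * L * d x y))"
    have "P n (Suc k) f x - P n (Suc k) f y
        \<le> ?e * (A * modulus (r * d x y)) + (1 - ?e) * (A * modulus 1)"
      unfolding normalized_op_Suc[OF x] normalized_op_Suc[OF y]
    proof (rule coupling_le[where B = B])
      show "?e * g (n + k) a x \<le> g (n + k) a y" if "a \<in> W (n + k)" for a
        using g_ratio[OF that x y] by (simp add: exp_minus field_simps)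
      show "P n k f (a ## x) - P n k f (a ## y) \<le> A * modulus (r * d x y)" if "a \<in> W (n + k)" for a
        using f that x y unfolding has_modulus_def
        by (metis SCons_in_shift_space abs_le_D1 shift_dist_SCons)
      show "P n k f (a ## x) - P n k f (b ## y) \<le> A * modulus 1"
        if "a \<in> W (n + k)" "b \<in> W (n + k)" for a b
      proof -
        have "P n k f (a ## x) - P n k f (b ## y) \<le> A * modulus (d (a ## x) (b ## y))"
          using f that x y unfolding has_modulus_def by (metis SCons_in_shift_space abs_le_D1)
        also have "\<dots> \<le> A * modulus 1" using A by (intro mult_left_mono modulus_mono) auto
        finally show ?thesis .
      qed
    qed (use x y B L_nonneg in \<open>auto intro: g_has_sum g_pos less_imp_le\<close>)
    also have "\<dots> = A * (?e * modulus (r * d x y) + (1 - ?e) * modulus 1)"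
      by (simp add: algebra_simps)
    also have "\<dots> \<le> A * (rate * modulus (d x y))"
      using A by (intro mult_left_mono modulus_contraction) auto
    finally show ?thesis by (simp add: mult_ac)
  qed
  show ?thesis
    unfolding has_modulus_def
    using one_sided by (force simp: abs_le_iff shift_dist_commute[of r])
qed

lemma has_modulus_normalized_op:
  assumes "has_modulus (n + k) A (P n k f)" "0 \<le> A"
  shows "has_modulus (n + (k + j)) (rate ^ j * A) (P n (k + j) f)"
proof (induction j)
  case (Suc j)
  then show ?case
    using has_modulus_normalized_op_Suc[of n "k + j" "rate ^ j * A" f] assms(2) rate_pos
    by (simp add: mult.assoc)
qed (use assms in simp)

text \<open>Maximum principle: weights of total mass 1 preserve upper and lower bounds, whatever
  step they are first known at.\<close>

lemma normalized_op_bounds: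
  assumes "\<And>x. x \<in> X (n + k) \<Longrightarrow> m \<le> P n k f x" "\<And>x. x \<in> X (n + k) \<Longrightarrow> P n k f x \<le> m'"
    and "x \<in> X (n + (k + j))"
  shows "m \<le> P n (k + j) f x \<and> P n (k + j) f x \<le> m'"
  using assms(3)
proof (induction j arbitrary: x)
  case (Suc j)
  have x: "x \<in> X (Suc (n + (k + j)))" using Suc.prems by simp
  have IH: "m \<le> P n (k + j) f (a ## x)" "P n (k + j) f (a ## x) \<le> m'" if "a \<in> W (n + (k + j))" for a
    using Suc.IH[of "a ## x"] that x by auto
  have B: "\<bar>P n (k + j) f (a ## x)\<bar> \<le> max \<bar>m\<bar> \<bar>m'\<bar>" if "a \<in> W (n + (k + j))" for a
    using IH[OF that] by linarith
  have "1 * m \<le> P n (Suc (k + j)) f x" "P n (Suc (k + j)) f x \<le> 1 * m'"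
    unfolding normalized_op_Suc[OF x]
    using g_has_sum[OF x] g_pos[OF _ x] IH B
    by (intro average_ge average_le; force intro: less_imp_le)+
  then show ?case by simp
qed (use assms in simp)

end

subsection \<open>Measurability\<close>

lemma space_cylinder_algebra: "space (cylinder_algebra W n) = shift_space W n"
  unfolding cylinder_algebra_def by (rule space_measure_of_conv)

lemma cylinder_in_sets:
  "w \<in> words W n k \<Longrightarrow> cylinder W n w \<in> sets (cylinder_algebra W n)"
  unfolding cylinder_algebra_def
  by (subst sets_measure_of) (auto simp: cylinder_def intro!: sigma_sets.Basic)

text \<open>There are countably many words, so preimages of single words suffice; these are
  cylinders or empty.\<close>

lemma measurable_stake [measurable]:
  "stake k \<in> cylinder_algebra W n \<rightarrow>\<^sub>M count_space UNIV"
proof (subst measurable_count_space_eq2_countable, intro conjI ballI)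
  show "stake k \<in> space (cylinder_algebra W n) \<rightarrow> UNIV" by simp
next
  fix w
  have eq: "stake k -` {w} \<inter> space (cylinder_algebra W n)
      = (if w \<in> words W n k then cylinder W n w else {})"
    by (auto simp: space_cylinder_algebra cylinder_def stake_in_words)
      (simp add: words_def)
  show "stake k -` {w} \<inter> space (cylinder_algebra W n) \<in> sets (cylinder_algebra W n)"
    unfolding eq by (auto intro: cylinder_in_sets)
qed

lemma measurable_shd [measurable]:
  "shd \<in> cylinder_algebra W n \<rightarrow>\<^sub>M count_space UNIV"
proof -
  have "shd = (\<lambda>x. hd (stake 1 x))" by (simp add: fun_eq_iff)
  moreover have "(\<lambda>x. hd (stake 1 x)) \<in> cylinder_algebra W n \<rightarrow>\<^sub>M count_space UNIV"
    by measurable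
  ultimately show ?thesis by simp
qed

lemma mem_cylinder_letter: "x \<in> cylinder W n [a] \<longleftrightarrow> x \<in> shift_space W n \<and> shd x = a"
  by (auto simp: cylinder_def)

lemma letter_in_words: "a \<in> W n \<Longrightarrow> [a] \<in> words W n 1"
  by (simp add: words_def)

lemma shd_eq_of_cylinder:
  assumes "x \<in> cylinder W n w" "y \<in> cylinder W n w" "w \<in> words W n k" "k \<ge> 1"
  shows "shd x = shd y"
proof -
  obtain j where "length w = Suc j" using assms(3,4) by (cases k) (auto simp: words_def)
  with assms(1,2) show ?thesis by (auto simp: cylinder_def)
qed

lemma local_holder_const_cong:
  "shd x = shd y \<Longrightarrow> local_holder_const r W n f x = local_holder_const r W n f y"
  by (simp add: local_holder_const_def)

lemma measurable_local_holder_const [measurable]: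
  "local_holder_const r W n f \<in> borel_measurable (cylinder_algebra W n)"
proof -
  \<comment> \<open>Only the head matters, so \<open>sconst (shd x)\<close> serves as a
    representative and the function factors through a discrete space. The representative need not
    lie in the shift space.\<close>
  have "local_holder_const r W n f = (\<lambda>x. local_holder_const r W n f (sconst (shd x)))"
    by (intro ext local_holder_const_cong) simp
  moreover have "(\<lambda>x. local_holder_const r W n f (sconst (shd x)))
      \<in> borel_measurable (cylinder_algebra W n)"
    by (rule measurable_compose[OF measurable_shd]) simp
  ultimately show ?thesis by simp
qed

lemma shift_append:
  assumes "x \<in> shift_space W n" "z \<in> shift_space W (n + k)"
  shows "stake k x @- z \<in> shift_space W n"
  using assms
proof (induction k arbitrary: n x)
  case (Suc k)
  then obtain a x' where "x = a ## x'" "a \<in> W n" "x' \<in> shift_space W (Suc n)"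
    by (metis shift_space_SConsE)
  with Suc show ?case by simp
qed simp

text \<open>Replacing the tail after k letters by a fixed admissible one gives functions of finitely
  many letters that converge to \<open>f\<close> pointwise.\<close>

lemma borel_measurable_locally_holder:
  assumes W: "\<And>n. W n \<noteq> {}" and r: "0 < r" "r < 1"
    and fin: "\<And>x. x \<in> shift_space W n \<Longrightarrow> local_holder_const r W n f x < \<infinity>"
  shows "f \<in> borel_measurable (cylinder_algebra W n)"
proof -
  have "\<forall>k. \<exists>z. z \<in> shift_space W (n + k)" using shift_space_nonempty[of W] W by blast
  then obtain z where z: "\<And>k. z k \<in> shift_space W (n + k)" by metis
  show ?thesis
  proof (rule borel_measurable_LIMSEQ_real)
    show "(\<lambda>x. f (stake k x @- z k)) \<in> borel_measurable (cylinder_algebra W n)" for k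
      by (rule measurable_compose[OF measurable_stake]) simp
  next
    fix x assume "x \<in> space (cylinder_algebra W n)"
    then have x: "x \<in> shift_space W n" by (simp add: space_cylinder_algebra)
    obtain H where H: "0 \<le> H" "local_holder_const r W n f x = ennreal H"
      using fin[OF x] by (metis ennreal_cases infinity_ennreal_def less_irrefl)
    \<comment> \<open>For k = 0 the replaced point may have another first letter, so the local
      constant applies from k = 1 on.\<close>
    have bound: "norm (f (stake k x @- z k) - f x) \<le> H * r ^ k" if "k \<ge> 1" for k
    proof -
      have k: "k = Suc (k - 1)" using that by simp
      have w: "stake k x \<in> words W n k" by (rule stake_in_words[OF x])
      have 1: "stake k x @- z k \<in> cylinder W n [shd x] \<inter> cylinder W n (stake k x)"
        using shift_append[OF x z, of k] k
        by (cases k) (auto simp: cylinder_def stake_shift)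
      have 2: "x \<in> cylinder W n [shd x] \<inter> cylinder W n (stake k x)"
        using x by (simp add: cylinder_def)
      have "ennreal (\<bar>f (stake k x @- z k) - f x\<bar> / r ^ k) \<le> local_holder_const r W n f x"
        unfolding local_holder_const_def
        by (intro Sup_upper CollectI exI conjI) (rule refl, rule that, rule w, rule 1, rule 2)
      then show ?thesis using H r by (simp add: field_simps)
    qed
    have "(\<lambda>k. H * r ^ k) \<longlonglongrightarrow> H * 0"
      using r by (intro tendsto_mult tendsto_const LIMSEQ_power_zero) simp
    then have lim: "(\<lambda>k. H * r ^ k) \<longlonglongrightarrow> 0" by simp
    have "(\<lambda>k. f (stake k x @- z k) - f x) \<longlonglongrightarrow> 0"
      by (rule Lim_null_comparison[OF eventually_sequentiallyI[of 1, OF bound] lim])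
    then show "(\<lambda>k. f (stake k x @- z k)) \<longlonglongrightarrow> f x" by (rule LIM_zero_cancel)
  qed
qed

section \<open>Sup-norm stability of the iterates\<close>

context holder_shift
begin

text \<open>Averaging does not increase the sup distance. It is stated from step k on, because a
  locally Hoelder function and its truncations become uniformly close only after one step.\<close>

lemma normalized_op_close:
  assumes B: "\<And>x. x \<in> X (n + k) \<Longrightarrow> \<bar>P n k f x\<bar> \<le> B" "\<And>x. x \<in> X (n + k) \<Longrightarrow> \<bar>P n k f' x\<bar> \<le> B"
    and close: "\<And>x. x \<in> X (n + k) \<Longrightarrow> \<bar>P n k f x - P n k f' x\<bar> \<le> \<epsilon>"
    and x: "x \<in> X (n + (k + j))"
  shows "\<bar>P n (k + j) f x - P n (k + j) f' x\<bar> \<le> \<epsilon>"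
  using x
proof (induction j arbitrary: x)
  case (Suc j)
  have x: "x \<in> X (Suc (n + (k + j)))" using Suc.prems by simp
  \<comment> \<open>The maximum principle keeps both iterates bounded, so both series converge and
    may be subtracted termwise.\<close>
  have bounded: "\<bar>P n (k + j) F (a ## x)\<bar> \<le> B"
    if "a \<in> W (n + (k + j))" "\<And>x. x \<in> X (n + k) \<Longrightarrow> \<bar>P n k F x\<bar> \<le> B" for F a
  proof -
    have "- B \<le> P n k F y \<and> P n k F y \<le> B" if "y \<in> X (n + k)" for y
      using \<open>\<And>x. x \<in> X (n + k) \<Longrightarrow> \<bar>P n k F x\<bar> \<le> B\<close>[OF that] by linarith
    then have "- B \<le> P n (k + j) F (a ## x) \<and> P n (k + j) F (a ## x) \<le> B"
      using that(1) x by (intro normalized_op_bounds) auto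
    then show ?thesis by linarith
  qed
  note g = g_has_sum[OF x] g_pos[OF _ x, THEN less_imp_le]
  have "P n (Suc (k + j)) f x - P n (Suc (k + j)) f' x
      = (\<Sum>\<^sub>\<infinity>a\<in>W (n + (k + j)). g (n + (k + j)) a x * (P n (k + j) f (a ## x) - P n (k + j) f' (a ## x)))"
    unfolding normalized_op_Suc[OF x] right_diff_distrib
    using g bounded B has_sum_imp_summable
    by (intro infsum_diff[symmetric] summable_on_mult_bounded[where B = B]) (blast | simp)+
  moreover have diff: "\<bar>P n (k + j) f (a ## x) - P n (k + j) f' (a ## x)\<bar> \<le> \<epsilon>"
    if "a \<in> W (n + (k + j))" for a
    using Suc.IH[of "a ## x"] that x by simp
  then have diff': "- \<epsilon> \<le> P n (k + j) f (a ## x) - P n (k + j) f' (a ## x)"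
    "P n (k + j) f (a ## x) - P n (k + j) f' (a ## x) \<le> \<epsilon>" if "a \<in> W (n + (k + j))" for a
    using that by (fastforce simp: abs_le_iff)+
  have "1 * - \<epsilon> \<le> (\<Sum>\<^sub>\<infinity>a\<in>W (n + (k + j)). g (n + (k + j)) a x * (P n (k + j) f (a ## x) - P n (k + j) f' (a ## x)))"
    using g diff diff' by (intro average_ge[where B = \<epsilon>]) auto
  moreover have "(\<Sum>\<^sub>\<infinity>a\<in>W (n + (k + j)). g (n + (k + j)) a x * (P n (k + j) f (a ## x) - P n (k + j) f' (a ## x))) \<le> 1 * \<epsilon>"
    using g diff diff' by (intro average_le[where B = \<epsilon>]) auto
  ultimately show ?case by simp
qed (use close in simp)

end

subsection \<open>Locally Hoelder functions and the limit measures\<close>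

locale holder_shift_measures = holder_shift +
  fixes \<nu> :: "nat \<Rightarrow> nat stream measure"
  assumes limit_nu: "limit_measures r W \<phi> \<nu>"
begin

lemma prob_space_nu: "prob_space (\<nu> n)"
  and sets_nu [measurable_cong]: "sets (\<nu> n) = sets (cylinder_algebra W n)"
  and limit_nu_holder: "f \<in> holder_space r W n \<Longrightarrow> (\<And>k. x k \<in> X (n + k)) \<Longrightarrow>
    (\<lambda>k. P n k f (x k)) \<longlonglongrightarrow> (\<integral>y. f y \<partial>\<nu> n)"
  using limit_nu by (auto simp: limit_measures_def)

lemma space_nu: "space (\<nu> n) = X n"
  using sets_eq_imp_space_eq[OF sets_nu] by (simp add: space_cylinder_algebra)

lemma cylinder_letter_in_sets: "a \<in> W n \<Longrightarrow> cylinder W n [a] \<in> sets (\<nu> n)"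
  unfolding sets_nu by (rule cylinder_in_sets[OF letter_in_words])

section \<open>Comparison of the transition weights with the masses of 1-cylinders\<close>

definition mass :: "nat \<Rightarrow> nat \<Rightarrow> real" where
  "mass n a = measure (\<nu> n) (cylinder W n [a])"

lemma emeasure_cylinder_letter: "emeasure (\<nu> n) (cylinder W n [a]) = ennreal (mass n a)"
proof -
  interpret prob_space "\<nu> n" by (rule prob_space_nu)
  show ?thesis by (simp add: mass_def emeasure_eq_measure)
qed

lemma normalized_op_1:
  assumes "x \<in> X (Suc n)"
  shows "P n (Suc 0) f x = (\<Sum>\<^sub>\<infinity>a\<in>W n. g n a x * f (a ## x))"
proof -
  have "P n (Suc 0) f x = (\<Sum>\<^sub>\<infinity>a\<in>W n. g n a x * P n 0 f (a ## x))"
    using normalized_op_Suc[of x n 0] assms by simp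
  also have "\<dots> = (\<Sum>\<^sub>\<infinity>a\<in>W n. g n a x * f (a ## x))"
    using assms by (intro infsum_cong) (simp add: normalized_op_0)
  finally show ?thesis .
qed

text \<open>The Hoelder constant compares only points with equal first letter, and there this
  indicator is constant.\<close>

lemma indicator_letter_in_holder_space:
  "(indicator (cylinder W n [a]) :: nat stream \<Rightarrow> real) \<in> holder_space r W n"
proof -
  let ?i = "indicator (cylinder W n [a]) :: nat stream \<Rightarrow> real"
  have "sup_norm W n ?i \<le> 1"
    unfolding sup_norm_def by (intro SUP_least) (auto simp: indicator_def)
  moreover have "holder_const r W n ?i \<le> 0"
    unfolding holder_const_def
  proof (intro Sup_least, clarify)
    fix x y w and k :: nat
    assume *: "1 \<le> k" "w \<in> words W n k" "x \<in> cylinder W n w" "y \<in> cylinder W n w"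
    then have "shd x = shd y" by (metis shd_eq_of_cylinder)
    moreover have "x \<in> X n" "y \<in> X n" using * by (auto simp: cylinder_def)
    ultimately have "?i x = ?i y" by (simp add: indicator_def mem_cylinder_letter)
    then show "ennreal (\<bar>?i x - ?i y\<bar> / r ^ k) \<le> 0" by simp
  qed
  ultimately have "sup_norm W n ?i + holder_const r W n ?i \<le> 1 + 0" by (rule add_mono)
  also have "\<dots> < \<infinity>" by simp
  finally show ?thesis by (simp add: holder_space_def)
qed

text \<open>One step maps the indicator of \<open>[a]\<close> to \<open>g n a\<close>, whose values
  differ by at most the factor \<open>exp (2 * L)\<close>. Later iterates keep the resulting lower
  bound, and their limit is the mass.\<close>

lemma g_le_mass:
  assumes a: "a \<in> W n" and x: "x \<in> X (Suc n)"
  shows "g n a x \<le> exp (2 * L) * mass n a"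
proof -
  interpret prob_space "\<nu> n" by (rule prob_space_nu)
  let ?i = "indicator (cylinder W n [a]) :: nat stream \<Rightarrow> real"
  have P1: "P n (Suc 0) ?i y = g n a y" if y: "y \<in> X (Suc n)" for y
  proof -
    have "P n (Suc 0) ?i y = (\<Sum>\<^sub>\<infinity>b\<in>{a}. g n b y * ?i (b ## y))"
      unfolding normalized_op_1[OF y] using a
      by (intro infsum_cong_neutral) (auto simp: mem_cylinder_letter indicator_def)
    then show ?thesis using a y by (simp add: indicator_def mem_cylinder_letter)
  qed
  have ratio: "g n a y \<le> exp (2 * L) * g n a z" if y: "y \<in> X (Suc n)" and z: "z \<in> X (Suc n)" for y z
  proof -
    have "g n a y \<le> exp (2 * L * d y z) * g n a z" using g_ratio[OF a y z] .
    also have "\<dots> \<le> exp (2 * L * 1) * g n a z"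
      using L_nonneg g_pos[OF a z] by (intro mult_right_mono) (auto simp: mult_left_le)
    finally show ?thesis by simp
  qed
  have "\<forall>k. \<exists>z. z \<in> X (n + k)" using shift_space_nonempty W_nonempty by blast
  then obtain z where z: "\<And>k. z k \<in> X (n + k)" by metis
  have lower: "exp (- (2 * L)) * g n a x \<le> P n k ?i (z k)" if "k \<ge> 1" for k
  proof -
    \<comment> \<open>Splitting k as 1 + (k - 1) starts the maximum principle after the first step,
      where the bounds first hold.\<close>
    have "exp (- (2 * L)) * g n a x \<le> P n (Suc 0 + (k - 1)) ?i (z k)
        \<and> P n (Suc 0 + (k - 1)) ?i (z k) \<le> exp (2 * L) * g n a x"
    proof (rule normalized_op_bounds)
      show "exp (- (2 * L)) * g n a x \<le> P n (Suc 0) ?i y" if "y \<in> X (n + Suc 0)" for y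
        using ratio[OF x, of y] that P1[of y] by (simp add: exp_minus field_simps)
      show "P n (Suc 0) ?i y \<le> exp (2 * L) * g n a x" if "y \<in> X (n + Suc 0)" for y
        using ratio[OF _ x, of y] that P1[of y] by simp
      show "z k \<in> X (n + (Suc 0 + (k - 1)))" using z[of k] that by simp
    qed
    then show ?thesis using that by simp
  qed
  have "(\<lambda>k. P n k ?i (z k)) \<longlonglongrightarrow> (\<integral>y. ?i y \<partial>\<nu> n)"
    by (intro limit_nu_holder indicator_letter_in_holder_space z)
  moreover have "(\<integral>y. ?i y \<partial>\<nu> n) = mass n a"
    using cylinder_letter_in_sets[OF a] by (simp add: mass_def sets.Int_space_eq2)
  ultimately have "exp (- (2 * L)) * g n a x \<le> mass n a"
    using lower by (intro LIMSEQ_le_const[of _ "mass n a"]) auto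
  then show ?thesis by (simp add: exp_minus field_simps)
qed

lemma mass_pos:
  assumes "a \<in> W n"
  shows "0 < mass n a"
proof -
  obtain x where x: "x \<in> X (Suc n)" using shift_space_nonempty W_nonempty by metis
  have "0 < exp (2 * L) * mass n a"
    using g_pos[OF assms x] g_le_mass[OF assms x] by linarith
  then show ?thesis by (simp add: zero_less_mult_iff)
qed

end

context holder_shift_measures
begin

section \<open>Letterwise majorants of a locally Hoelder function\<close>

context
  fixes n :: nat and f :: "nat stream \<Rightarrow> real"
  assumes f_local: "f \<in> local_holder_space r W \<nu> n"
begin

abbreviation "D \<equiv> local_holder_const r W n f"

definition R :: real where
  "R = enn2real (local_holder_norm r W \<nu> n f)"

text \<open>The share of the letter \<open>a\<close> in the local norm. These shares form the
  summable majorant for all series over letters below.\<close>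

definition \<beta> :: "nat \<Rightarrow> real" where
  "\<beta> a = enn2real (\<integral>\<^sup>+x. (ennreal \<bar>f x\<bar> + D x) * indicator (cylinder W n [a]) x \<partial>\<nu> n)"

text \<open>A finite integral forces finiteness at every point, not just almost everywhere: the
  function is constant on 1-cylinders and these have positive mass.\<close>

lemma local_holder_const_finite:
  assumes x: "x \<in> X n"
  shows "D x < \<infinity>"
proof -
  have a: "shd x \<in> W n" using x by (rule shd_in_alphabet)
  have "D x * ennreal (mass n (shd x)) = (\<integral>\<^sup>+y. D x * indicator (cylinder W n [shd x]) y \<partial>\<nu> n)"
    using cylinder_letter_in_sets[OF a] by (simp add: nn_integral_cmult_indicator emeasure_cylinder_letter)
  also have "\<dots> \<le> (\<integral>\<^sup>+y. D y \<partial>\<nu> n)"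
    by (intro nn_integral_mono)
      (auto simp: indicator_def mem_cylinder_letter intro: eq_refl[OF local_holder_const_cong])
  also have "\<dots> < \<infinity>" using f_local by (simp add: local_holder_space_def)
  finally show ?thesis using mass_pos[OF a] by (auto simp: ennreal_mult_less_top)
qed

lemma ennreal_enn2real_D:
  assumes "x \<in> X n"
  shows "ennreal (enn2real (D x)) = D x"
  using local_holder_const_finite[OF assms] by simp

lemma f_diff_le:
  assumes "x \<in> X n" "y \<in> X n" "shd x = shd y"
  shows "\<bar>f x - f y\<bar> \<le> enn2real (D y) * d x y"
  using assms ennreal_enn2real_D[of y] r_pos
  by (intro local_holder_const_bound[where z = y]) auto

lemma f_measurable: "f \<in> borel_measurable (\<nu> n)"
  unfolding measurable_cong_sets[OF sets_nu refl]
  by (rule borel_measurable_locally_holder[OF W_nonempty r_pos r_less_1 local_holder_const_finite])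

lemma D_measurable: "D \<in> borel_measurable (\<nu> n)"
  unfolding measurable_cong_sets[OF sets_nu refl] by (rule measurable_local_holder_const)

lemma local_holder_norm_eq: "local_holder_norm r W \<nu> n f = (\<integral>\<^sup>+x. ennreal \<bar>f x\<bar> + D x \<partial>\<nu> n)"
  unfolding local_holder_norm_def
  using f_measurable D_measurable by (simp add: nn_integral_add)

lemma local_holder_norm_eq_R: "local_holder_norm r W \<nu> n f = ennreal R"
  using f_local by (simp add: R_def local_holder_norm_def local_holder_space_def)

lemma R_nonneg: "0 \<le> R"
  by (simp add: R_def)

lemma sum_letters_le:
  assumes F: "finite F" "F \<subseteq> W n"
  shows "(\<Sum>a\<in>F. \<integral>\<^sup>+x. (ennreal \<bar>f x\<bar> + D x) * indicator (cylinder W n [a]) x \<partial>\<nu> n) \<le> ennreal R"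
proof -
  have "(\<Sum>a\<in>F. \<integral>\<^sup>+x. (ennreal \<bar>f x\<bar> + D x) * indicator (cylinder W n [a]) x \<partial>\<nu> n)
      = (\<integral>\<^sup>+x. (\<Sum>a\<in>F. (ennreal \<bar>f x\<bar> + D x) * indicator (cylinder W n [a]) x) \<partial>\<nu> n)"
    using F f_measurable D_measurable cylinder_letter_in_sets
    by (intro nn_integral_sum[symmetric] borel_measurable_times_ennreal borel_measurable_add
        borel_measurable_indicator measurable_compose[OF _ measurable_ennreal]
        borel_measurable_abs) auto
  also have "\<dots> \<le> (\<integral>\<^sup>+x. ennreal \<bar>f x\<bar> + D x \<partial>\<nu> n)"
  proof (rule nn_integral_mono)
    fix x assume "x \<in> space (\<nu> n)"
    \<comment> \<open>The 1-cylinders are disjoint, so at most one term survives; none does if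
      \<open>shd x\<close> lies outside \<open>F\<close>.\<close>
    then have "(\<Sum>a\<in>F. indicator (cylinder W n [a]) x :: ennreal) = (\<Sum>a\<in>F. if a = shd x then 1 else 0)"
      by (intro sum.cong) (auto simp: mem_cylinder_letter indicator_def space_nu)
    also have "\<dots> \<le> 1" using F by simp
    finally have "(ennreal \<bar>f x\<bar> + D x) * (\<Sum>a\<in>F. indicator (cylinder W n [a]) x) \<le> (ennreal \<bar>f x\<bar> + D x) * 1"
      by (rule mult_left_mono) simp
    then show "(\<Sum>a\<in>F. (ennreal \<bar>f x\<bar> + D x) * indicator (cylinder W n [a]) x) \<le> ennreal \<bar>f x\<bar> + D x"
      by (simp add: sum_distrib_left)
  qed
  finally show ?thesis by (simp flip: local_holder_norm_eq add: local_holder_norm_eq_R)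
qed

lemma beta_eq:
  assumes "a \<in> W n"
  shows "(\<integral>\<^sup>+x. (ennreal \<bar>f x\<bar> + D x) * indicator (cylinder W n [a]) x \<partial>\<nu> n) = ennreal (\<beta> a)"
proof -
  have "(\<integral>\<^sup>+x. (ennreal \<bar>f x\<bar> + D x) * indicator (cylinder W n [a]) x \<partial>\<nu> n) \<le> ennreal R"
    using sum_letters_le[of "{a}"] assms by simp
  also have "\<dots> < \<infinity>" by simp
  finally show ?thesis by (simp add: \<beta>_def)
qed

lemma beta_nonneg: "0 \<le> \<beta> a"
  by (simp add: \<beta>_def)

lemma sum_beta_le:
  assumes "finite F" "F \<subseteq> W n"
  shows "sum \<beta> F \<le> R"
proof -
  have "ennreal (sum \<beta> F) = (\<Sum>a\<in>F. ennreal (\<beta> a))"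
    by (simp add: beta_nonneg)
  also have "\<dots> = (\<Sum>a\<in>F. \<integral>\<^sup>+x. (ennreal \<bar>f x\<bar> + D x) * indicator (cylinder W n [a]) x \<partial>\<nu> n)"
    using assms by (intro sum.cong) (auto simp: beta_eq)
  also have "\<dots> \<le> ennreal R" using assms by (rule sum_letters_le)
  finally show ?thesis using R_nonneg by simp
qed

lemma beta_summable: "\<beta> summable_on W n"
  by (rule nonneg_bounded_partial_sums_imp_summable_on[of _ _ R])
    (auto simp: beta_nonneg sum_beta_le intro!: eventually_finite_subsets_at_top_weakI)

lemma infsum_beta_le: "infsum \<beta> (W n) \<le> R"
  using beta_summable by (rule infsum_le_finite_sums) (rule sum_beta_le)

text \<open>Integrate the constant lower bound \<open>t\<close> over the 1-cylinder.\<close>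

lemma mass_le_beta:
  assumes a: "a \<in> W n" and t: "\<And>y. y \<in> cylinder W n [a] \<Longrightarrow> ennreal t \<le> ennreal \<bar>f y\<bar> + D y"
    and "0 \<le> t"
  shows "t * mass n a \<le> \<beta> a"
proof -
  have "ennreal (t * mass n a) = (\<integral>\<^sup>+y. ennreal t * indicator (cylinder W n [a]) y \<partial>\<nu> n)"
    using cylinder_letter_in_sets[OF a] \<open>0 \<le> t\<close> mass_pos[OF a]
    by (simp add: nn_integral_cmult_indicator emeasure_cylinder_letter ennreal_mult)
  also have "\<dots> \<le> ennreal (\<beta> a)"
    unfolding beta_eq[OF a, symmetric] using t
    by (intro nn_integral_mono) (auto simp: indicator_def)
  finally show ?thesis by (simp add: beta_nonneg)
qed

text \<open>Distances are at most 1, so |f(x)| is at most |f(y)| + D(y) for every y with the same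
  first letter. This is why \<open>\<beta>\<close> integrates that sum.\<close>

lemma f_mass_le_beta:
  assumes x: "x \<in> X n"
  shows "\<bar>f x\<bar> * mass n (shd x) \<le> \<beta> (shd x)"
proof (rule mass_le_beta[OF shd_in_alphabet[OF x]])
  fix y assume "y \<in> cylinder W n [shd x]"
  then have y: "y \<in> X n" "shd x = shd y" by (auto simp: mem_cylinder_letter)
  have "\<bar>f x - f y\<bar> \<le> enn2real (D y) * d x y" using x y by (rule f_diff_le)
  also have "\<dots> \<le> enn2real (D y)" by (simp add: mult_left_le)
  finally have "\<bar>f x\<bar> \<le> \<bar>f y\<bar> + enn2real (D y)" by linarith
  then have "ennreal \<bar>f x\<bar> \<le> ennreal (\<bar>f y\<bar> + enn2real (D y))" by (rule ennreal_leI)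
  then show "ennreal \<bar>f x\<bar> \<le> ennreal \<bar>f y\<bar> + D y"
    using ennreal_enn2real_D[OF y(1)] by simp
qed simp

lemma D_mass_le_beta:
  assumes x: "x \<in> X n"
  shows "enn2real (D x) * mass n (shd x) \<le> \<beta> (shd x)"
proof (rule mass_le_beta[OF shd_in_alphabet[OF x]])
  fix y assume "y \<in> cylinder W n [shd x]"
  then have "D x = D y" by (intro local_holder_const_cong) (simp add: mem_cylinder_letter)
  then show "ennreal (enn2real (D x)) \<le> ennreal \<bar>f y\<bar> + D y"
    using ennreal_enn2real_D[OF x] by simp
qed simp

text \<open>The weight is dominated by the mass, and mass times |f| by \<open>\<beta>\<close>; the
  majorant does not depend on the point.\<close>

lemma g_f_le:
  assumes a: "a \<in> W n" and x: "x \<in> X (Suc n)"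
  shows "\<bar>g n a x * f (a ## x)\<bar> \<le> exp (2 * L) * \<beta> a"
proof -
  have "\<bar>g n a x * f (a ## x)\<bar> = g n a x * \<bar>f (a ## x)\<bar>"
    using g_pos[OF a x] by (simp add: abs_mult)
  also have "\<dots> \<le> exp (2 * L) * mass n a * \<bar>f (a ## x)\<bar>"
    using g_le_mass[OF a x] by (rule mult_right_mono) simp
  also have "\<dots> = exp (2 * L) * (\<bar>f (a ## x)\<bar> * mass n a)" by simp
  also have "\<dots> \<le> exp (2 * L) * \<beta> a"
    using f_mass_le_beta[of "a ## x"] a x by (intro mult_left_mono) auto
  finally show ?thesis .
qed

lemma g_f_summable:
  assumes x: "x \<in> X (Suc n)"
  shows "(\<lambda>a. g n a x * f (a ## x)) summable_on W n"
proof (rule summable_on_iff_abs_summable_on_real[THEN iffD2, OF Infinite_Sum.abs_summable_on_comparison_test'])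
  show "(\<lambda>a. exp (2 * L) * \<beta> a) summable_on W n"
    by (intro summable_on_cmult_right beta_summable)
qed (use g_f_le[OF _ x] in simp)

end

text \<open>The first summand pays for the variation of the weights, the second for that of the
  function, as in \<open>g_f_diff_le\<close>.\<close>

definition lip_factor :: real where
  "lip_factor = 2 * L * exp (2 * L) * exp (2 * L) + exp (2 * L)"

lemma lip_factor_pos: "0 < lip_factor"
  using L_nonneg by (simp add: lip_factor_def add_nonneg_pos)

lemma g_diff_le:
  assumes a: "a \<in> W n" and x: "x \<in> X (Suc n)" and y: "y \<in> X (Suc n)"
  shows "\<bar>g n a x - g n a y\<bar> \<le> 2 * L * exp (2 * L) * d x y * (exp (2 * L) * mass n a)"
proof -
  have one_sided: "g n a x - g n a y \<le> 2 * L * exp (2 * L) * d x y * (exp (2 * L) * mass n a)"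
    if x: "x \<in> X (Suc n)" and y: "y \<in> X (Suc n)" for x y
  proof -
    let ?u = "2 * L * d x y"
    have u: "0 \<le> ?u" "?u \<le> 2 * L" using L_nonneg by (auto simp: mult_left_le)
    \<comment> \<open>This converts the multiplicative distortion of the weights into an additive
      bound, linear in the distance.\<close>
    have "exp ?u - 1 = exp ?u * (1 - exp (- ?u))" by (simp add: right_diff_distrib flip: exp_add)
    also have "\<dots> \<le> exp (2 * L) * ?u"
      using u exp_ge_add_one_self[of "- ?u"] by (intro mult_mono) auto
    finally have e: "exp ?u - 1 \<le> exp (2 * L) * ?u" .
    have "g n a x - g n a y \<le> (exp ?u - 1) * g n a y"
      using g_ratio[OF a x y] by (simp add: algebra_simps)
    also have "\<dots> \<le> (exp (2 * L) * ?u) * (exp (2 * L) * mass n a)"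
      using e u g_le_mass[OF a y] g_pos[OF a y] by (intro mult_mono) auto
    finally show ?thesis by (simp add: mult_ac)
  qed
  show ?thesis using one_sided[OF x y] one_sided[OF y x]
    by (simp add: abs_le_iff shift_dist_commute[of r y])
qed

section \<open>Lipschitz bound after one step and its exponential decay\<close>

context
  fixes n :: nat and f :: "nat stream \<Rightarrow> real"
  assumes f_local: "f \<in> local_holder_space r W \<nu> n"
begin

text \<open>Product rule: vary the weight first and then the function, absorbing each mass into
  \<open>\<beta>\<close>.\<close>

lemma g_f_diff_le:
  assumes a: "a \<in> W n" and x: "x \<in> X (Suc n)" and y: "y \<in> X (Suc n)"
  shows "\<bar>g n a x * f (a ## x) - g n a y * f (a ## y)\<bar> \<le> lip_factor * d x y * \<beta> n f a"
proof -
  let ?E = "exp (2 * L)" and ?D = "enn2real (local_holder_const r W n f (a ## y))"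
  have "\<bar>(g n a x - g n a y) * f (a ## x)\<bar> \<le> 2 * L * ?E * d x y * (?E * mass n a) * \<bar>f (a ## x)\<bar>"
    unfolding abs_mult using g_diff_le[OF a x y] by (rule mult_right_mono) simp
  also have "\<dots> = 2 * L * ?E * ?E * d x y * (\<bar>f (a ## x)\<bar> * mass n a)" by simp
  also have "\<dots> \<le> 2 * L * ?E * ?E * d x y * \<beta> n f a"
    using f_mass_le_beta[OF f_local, of "a ## x"] a x L_nonneg by (intro mult_left_mono) auto
  finally have 1: "\<bar>(g n a x - g n a y) * f (a ## x)\<bar> \<le> 2 * L * ?E * ?E * d x y * \<beta> n f a" .
  have "\<bar>f (a ## x) - f (a ## y)\<bar> \<le> ?D * (r * d x y)"
    using f_diff_le[OF f_local, of "a ## x" "a ## y"] a x y by simp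
  also have "\<dots> \<le> ?D * d x y"
    using r_pos r_less_1 by (intro mult_left_mono) (auto simp: mult_left_le_one_le)
  finally have "\<bar>g n a y * (f (a ## x) - f (a ## y))\<bar> \<le> ?E * mass n a * (?D * d x y)"
    unfolding abs_mult using g_le_mass[OF a y] g_pos[OF a y] mass_pos[OF a]
    by (intro mult_mono) auto
  also have "\<dots> = ?E * d x y * (?D * mass n a)" by simp
  also have "\<dots> \<le> ?E * d x y * \<beta> n f a"
    using D_mass_le_beta[OF f_local, of "a ## y"] a y by (intro mult_left_mono) auto
  finally have 2: "\<bar>g n a y * (f (a ## x) - f (a ## y))\<bar> \<le> ?E * d x y * \<beta> n f a" .
  have "g n a x * f (a ## x) - g n a y * f (a ## y)
      = (g n a x - g n a y) * f (a ## x) + g n a y * (f (a ## x) - f (a ## y))"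
    by (simp add: algebra_simps)
  then show ?thesis using 1 2 by (simp add: lip_factor_def distrib_right)
qed

lemma normalized_op_1_lipschitz:
  assumes x: "x \<in> X (Suc n)" and y: "y \<in> X (Suc n)"
  shows "\<bar>P n (Suc 0) f x - P n (Suc 0) f y\<bar> \<le> lip_factor * R n f * d x y"
proof -
  let ?\<Delta> = "\<lambda>a. g n a x * f (a ## x) - g n a y * f (a ## y)"
  have sum: "(\<lambda>a. lip_factor * d x y * \<beta> n f a) summable_on W n"
    by (intro summable_on_cmult_right beta_summable f_local)
  then have abs: "(\<lambda>a. norm (?\<Delta> a)) summable_on W n"
    using g_f_diff_le[OF _ x y] by (intro Infinite_Sum.abs_summable_on_comparison_test'[OF sum]) simp
  have "P n (Suc 0) f x - P n (Suc 0) f y = infsum ?\<Delta> (W n)"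
    unfolding normalized_op_1[OF x] normalized_op_1[OF y]
    by (rule infsum_diff[symmetric]) (intro g_f_summable f_local x y)+
  then have "\<bar>P n (Suc 0) f x - P n (Suc 0) f y\<bar> \<le> (\<Sum>\<^sub>\<infinity>a\<in>W n. norm (?\<Delta> a))"
    using norm_infsum_bound[OF abs] by simp
  also have "\<dots> \<le> (\<Sum>\<^sub>\<infinity>a\<in>W n. lip_factor * d x y * \<beta> n f a)"
    using g_f_diff_le[OF _ x y] by (intro infsum_mono abs sum) simp
  also have "\<dots> = lip_factor * d x y * infsum (\<beta> n f) (W n)" by (rule infsum_cmult_right')
  also have "\<dots> \<le> lip_factor * d x y * R n f"
    using lip_factor_pos by (intro mult_left_mono infsum_beta_le f_local) auto
  finally show ?thesis by (simp add: mult_ac)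
qed

text \<open>The contraction starts after the first step, since \<open>f\<close> itself may be
  unbounded. Hence \<open>Suc j\<close> steps gain only \<open>rate ^ j\<close>.\<close>

lemma normalized_op_lipschitz:
  assumes x: "x \<in> X (n + Suc j)" and y: "y \<in> X (n + Suc j)"
  shows "\<bar>P n (Suc j) f x - P n (Suc j) f y\<bar>
    \<le> rate ^ j * ((\<kappa> + c) / c * lip_factor * R n f) * d x y"
proof -
  \<comment> \<open>Passing from distance to modulus costs 1 / c by \<open>modulus_ge\<close>;
    passing back costs \<kappa> + c by \<open>modulus_le\<close>.\<close>
  let ?A = "lip_factor * R n f / c"
  have A: "0 \<le> ?A" using lip_factor_pos R_nonneg[OF f_local] c_pos by simp
  have "has_modulus (n + Suc 0) ?A (P n (Suc 0) f)"
    unfolding has_modulus_def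
  proof (intro ballI)
    fix x y assume "x \<in> X (n + Suc 0)" "y \<in> X (n + Suc 0)"
    then have "\<bar>P n (Suc 0) f x - P n (Suc 0) f y\<bar> \<le> lip_factor * R n f * d x y"
      by (intro normalized_op_1_lipschitz) auto
    also have "\<dots> = ?A * (c * d x y)" using c_pos by simp
    also have "\<dots> \<le> ?A * modulus (d x y)" using A by (intro mult_left_mono modulus_ge) auto
    finally show "\<bar>P n (Suc 0) f x - P n (Suc 0) f y\<bar> \<le> ?A * modulus (d x y)" .
  qed
  then have "has_modulus (n + (Suc 0 + j)) (rate ^ j * ?A) (P n (Suc 0 + j) f)"
    using A by (rule has_modulus_normalized_op)
  then have "\<bar>P n (Suc j) f x - P n (Suc j) f y\<bar> \<le> rate ^ j * ?A * modulus (d x y)"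
    using x y by (simp add: has_modulus_def)
  also have "\<dots> \<le> rate ^ j * ?A * ((\<kappa> + c) * d x y)"
    by (intro mult_left_mono modulus_le mult_nonneg_nonneg A zero_le_power less_imp_le[OF rate_pos])
  finally show ?thesis by (simp add: field_simps)
qed

section \<open>Truncation to finitely many first letters and convergence to the integral\<close>

definition trunc :: "nat \<Rightarrow> nat stream \<Rightarrow> real" where
  "trunc m x = (if shd x \<le> m then f x else 0)"

definition tail :: "nat \<Rightarrow> real" where
  "tail m = (\<Sum>\<^sub>\<infinity>a\<in>W n. if a \<le> m then 0 else \<beta> n f a)"

lemma tail_has_sum:
  "((\<lambda>a. if a \<le> m then 0 else \<beta> n f a) has_sum (infsum (\<beta> n f) (W n) - sum (\<beta> n f) (W n \<inter> {..m}))) (W n)"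
proof -
  have "((\<lambda>a. if a \<le> m then \<beta> n f a else 0) has_sum sum (\<beta> n f) (W n \<inter> {..m})) (W n)
      \<longleftrightarrow> (\<beta> n f has_sum sum (\<beta> n f) (W n \<inter> {..m})) (W n \<inter> {..m})"
    by (rule has_sum_cong_neutral) auto
  then have "((\<lambda>a. if a \<le> m then \<beta> n f a else 0) has_sum sum (\<beta> n f) (W n \<inter> {..m})) (W n)"
    by (simp add: has_sum_finite)
  from has_sum_diff[OF has_sum_infsum[OF beta_summable[OF f_local]] this]
  have "((\<lambda>a. \<beta> n f a - (if a \<le> m then \<beta> n f a else 0)) has_sum
      (infsum (\<beta> n f) (W n) - sum (\<beta> n f) (W n \<inter> {..m}))) (W n)" .
  then show ?thesis by (rule has_sum_cong[THEN iffD1, rotated]) simp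
qed

lemma tail_eq: "tail m = infsum (\<beta> n f) (W n) - sum (\<beta> n f) (W n \<inter> {..m})"
  unfolding tail_def by (rule infsumI[OF tail_has_sum])

text \<open>The finite sets \<open>W n \<inter> {..m}\<close> eventually contain every finite subset
  of \<open>W n\<close>, so sums along them reach the full sum.\<close>

lemma tail_tendsto: "tail \<longlonglongrightarrow> 0"
proof -
  have "filterlim (\<lambda>m. W n \<inter> {..m}) (finite_subsets_at_top (W n)) sequentially"
    unfolding filterlim_finite_subsets_at_top
  proof (intro allI impI)
    fix F :: "nat set" assume F: "finite F \<and> F \<subseteq> W n"
    then obtain k where "\<And>a. a \<in> F \<Longrightarrow> a \<le> k"
      using finite_nat_set_iff_bounded_le by metis
    with F show "\<forall>\<^sub>F m in sequentially. finite (W n \<inter> {..m}) \<and> F \<subseteq> W n \<inter> {..m} \<and> W n \<inter> {..m} \<subseteq> W n"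
      by (intro eventually_sequentiallyI[of k]) fastforce
  qed
  then have "(\<lambda>m. sum (\<beta> n f) (W n \<inter> {..m})) \<longlonglongrightarrow> infsum (\<beta> n f) (W n)"
    using has_sum_infsum[OF beta_summable[OF f_local]] unfolding has_sum_def
    by (rule filterlim_compose[rotated])
  from tendsto_diff[OF tendsto_const this, of "infsum (\<beta> n f) (W n)"]
  show ?thesis by (simp add: tail_eq[abs_def])
qed

text \<open>Cutting off by the first letter creates no jump inside a 1-cylinder, and sums over the
  finitely many remaining letters bound both the sup norm and the Hoelder constant.\<close>

lemma trunc_in_holder_space: "trunc m \<in> holder_space r W n"
proof -
  \<comment> \<open>The tail \<open>?z\<close> supplies a point \<open>a ## ?z\<close> in each
    1-cylinder at which to read off its local constant.\<close>
  let ?F = "W n \<inter> {..m}" and ?z = "SOME z. z \<in> X (Suc n)"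
  let ?H = "\<lambda>a. enn2real (local_holder_const r W n f (a ## ?z))"
  have z: "?z \<in> X (Suc n)" using shift_space_nonempty[OF W_nonempty] by (rule someI_ex)
  have "sup_norm W n (trunc m) \<le> ennreal (\<Sum>a\<in>?F. \<beta> n f a / mass n a)"
    unfolding sup_norm_def
  proof (intro SUP_least ennreal_leI)
    fix x assume x: "x \<in> X n"
    note a = shd_in_alphabet[OF x]
    show "\<bar>trunc m x\<bar> \<le> (\<Sum>a\<in>?F. \<beta> n f a / mass n a)"
    proof (cases "shd x \<le> m")
      case True
      have "\<bar>f x\<bar> \<le> \<beta> n f (shd x) / mass n (shd x)"
        using f_mass_le_beta[OF f_local x] mass_pos[OF a] by (simp add: field_simps)
      also have "\<dots> \<le> (\<Sum>a\<in>?F. \<beta> n f a / mass n a)"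
        using a True beta_nonneg[OF f_local] mass_pos
        by (intro member_le_sum[of "shd x" ?F "\<lambda>a. \<beta> n f a / mass n a"]) (auto simp: less_imp_le)
      finally show ?thesis using True by (simp add: trunc_def)
    qed (use beta_nonneg[OF f_local] mass_pos in \<open>auto simp: trunc_def less_imp_le intro!: sum_nonneg\<close>)
  qed
  moreover have "holder_const r W n (trunc m) \<le> ennreal (\<Sum>a\<in>?F. ?H a)"
    unfolding holder_const_def
  proof (intro Sup_least, clarify)
    fix x y w and k :: nat
    assume *: "1 \<le> k" "w \<in> words W n k" "x \<in> cylinder W n w" "y \<in> cylinder W n w"
    then have shd: "shd y = shd x" by (metis shd_eq_of_cylinder)
    have x: "x \<in> X n" "y \<in> X n" using * by (auto simp: cylinder_def)
    note a = shd_in_alphabet[OF x(1)]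
    show "ennreal (\<bar>trunc m x - trunc m y\<bar> / r ^ k) \<le> ennreal (\<Sum>a\<in>?F. ?H a)"
    proof (cases "shd x \<le> m")
      case True
      have 1: "x \<in> cylinder W n [shd x] \<inter> cylinder W n w" "y \<in> cylinder W n [shd x] \<inter> cylinder W n w"
        using * x shd by (auto simp: mem_cylinder_letter)
      have "ennreal (\<bar>f x - f y\<bar> / r ^ k) \<le> local_holder_const r W n f x"
        unfolding local_holder_const_def
        by (intro Sup_upper CollectI exI conjI) (rule refl, rule *(1), rule *(2), rule 1, rule 1)
      also have "\<dots> = ennreal (?H (shd x))"
        using ennreal_enn2real_D[OF f_local, of "shd x ## ?z"] a z
        by (simp add: local_holder_const_cong[of x "shd x ## ?z"])
      also have "\<dots> \<le> ennreal (\<Sum>a\<in>?F. ?H a)"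
        using a True by (intro ennreal_leI member_le_sum[of "shd x" ?F ?H]) auto
      finally show ?thesis using True shd by (simp add: trunc_def)
    qed (use shd in \<open>simp add: trunc_def\<close>)
  qed
  ultimately have "sup_norm W n (trunc m) + holder_const r W n (trunc m)
      \<le> ennreal (\<Sum>a\<in>?F. \<beta> n f a / mass n a) + ennreal (\<Sum>a\<in>?F. ?H a)"
    by (rule add_mono)
  also have "\<dots> < \<infinity>" by simp
  finally show ?thesis by (simp add: holder_space_def)
qed

text \<open>The two functions differ only at letters above m, where \<open>g_f_le\<close> bounds
  each term. The error is uniform in the point.\<close>

lemma normalized_op_1_trunc_close:
  assumes x: "x \<in> X (Suc n)"
  shows "\<bar>P n (Suc 0) f x - P n (Suc 0) (trunc m) x\<bar> \<le> exp (2 * L) * tail m"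
proof -
  let ?\<Delta> = "\<lambda>a. g n a x * f (a ## x) - g n a x * trunc m (a ## x)"
  let ?t = "\<lambda>a. if a \<le> m then 0 else \<beta> n f a"
  have \<Delta>: "norm (?\<Delta> a) \<le> exp (2 * L) * ?t a" if "a \<in> W n" for a
    using g_f_le[OF f_local that x] by (simp add: trunc_def)
  have sum: "(\<lambda>a. exp (2 * L) * ?t a) summable_on W n"
    by (intro summable_on_cmult_right has_sum_imp_summable[OF tail_has_sum])
  have abs: "(\<lambda>a. norm (?\<Delta> a)) summable_on W n"
    using \<Delta> by (rule Infinite_Sum.abs_summable_on_comparison_test'[OF sum])
  have f: "(\<lambda>a. g n a x * f (a ## x)) summable_on W n"
    using f_local x by (rule g_f_summable)
  have "(\<lambda>a. norm (g n a x * trunc m (a ## x))) summable_on W n"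
  proof (rule Infinite_Sum.abs_summable_on_comparison_test')
    show "(\<lambda>a. norm (g n a x * f (a ## x))) summable_on W n"
      using f by (rule summable_on_iff_abs_summable_on_real[THEN iffD1])
  qed (simp add: trunc_def)
  then have t: "(\<lambda>a. g n a x * trunc m (a ## x)) summable_on W n"
    by (rule summable_on_iff_abs_summable_on_real[THEN iffD2])
  have "P n (Suc 0) f x - P n (Suc 0) (trunc m) x = infsum ?\<Delta> (W n)"
    unfolding normalized_op_1[OF x] using f t by (rule infsum_diff[symmetric])
  then have "\<bar>P n (Suc 0) f x - P n (Suc 0) (trunc m) x\<bar> \<le> (\<Sum>\<^sub>\<infinity>a\<in>W n. norm (?\<Delta> a))"
    using norm_infsum_bound[OF abs] by simp
  also have "\<dots> \<le> (\<Sum>\<^sub>\<infinity>a\<in>W n. exp (2 * L) * ?t a)"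
    using \<Delta> by (intro infsum_mono abs sum)
  also have "\<dots> = exp (2 * L) * tail m"
    unfolding tail_def by (rule infsum_cmult_right')
  finally show ?thesis .
qed

lemma normalized_op_trunc_close:
  assumes x: "x \<in> X (n + Suc j)"
  shows "\<bar>P n (Suc j) f x - P n (Suc j) (trunc m) x\<bar> \<le> exp (2 * L) * tail m"
proof -
  obtain z where z: "z \<in> X (Suc n)" using shift_space_nonempty W_nonempty by metis
  \<comment> \<open>A Lipschitz function on a space of diameter at most 1 is bounded; the last
    summand covers the truncation.\<close>
  let ?B = "\<bar>P n (Suc 0) f z\<bar> + lip_factor * R n f + exp (2 * L) * tail m"
  have f: "\<bar>P n (Suc 0) f y\<bar> \<le> \<bar>P n (Suc 0) f z\<bar> + lip_factor * R n f" if "y \<in> X (Suc n)" for y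
  proof -
    have "\<bar>P n (Suc 0) f y - P n (Suc 0) f z\<bar> \<le> lip_factor * R n f * d y z"
      using that z by (rule normalized_op_1_lipschitz)
    also have "\<dots> \<le> lip_factor * R n f"
      using lip_factor_pos R_nonneg[OF f_local] by (intro mult_left_le) auto
    finally show ?thesis by linarith
  qed
  have close: "\<bar>P n (Suc 0) f y - P n (Suc 0) (trunc m) y\<bar> \<le> exp (2 * L) * tail m"
    if "y \<in> X (n + Suc 0)" for y
    using normalized_op_1_trunc_close[of y] that by simp
  have "\<bar>P n (Suc 0 + j) f x - P n (Suc 0 + j) (trunc m) x\<bar> \<le> exp (2 * L) * tail m"
  proof (rule normalized_op_close[where B = ?B])
    show "\<bar>P n (Suc 0) f y\<bar> \<le> ?B" if "y \<in> X (n + Suc 0)" for y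
      using f[of y] close[OF that] that by simp
    show "\<bar>P n (Suc 0) (trunc m) y\<bar> \<le> ?B" if "y \<in> X (n + Suc 0)" for y
      using f[of y] close[OF that] that by simp
  qed (use close x in simp_all)
  then show ?thesis by simp
qed

lemma integral_trunc_tendsto: "(\<lambda>m. \<integral>y. trunc m y \<partial>\<nu> n) \<longlonglongrightarrow> (\<integral>y. f y \<partial>\<nu> n)"
proof (rule integral_dominated_convergence[where w = "\<lambda>y. \<bar>f y\<bar>"])
  note [measurable] = f_measurable[OF f_local]
  have [measurable]: "shd \<in> \<nu> n \<rightarrow>\<^sub>M count_space UNIV"
    unfolding measurable_cong_sets[OF sets_nu refl] by (rule measurable_shd)
  show "trunc m \<in> borel_measurable (\<nu> n)" for m
    unfolding trunc_def[abs_def] by measurable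
  show "integrable (\<nu> n) (\<lambda>y. \<bar>f y\<bar>)"
    using f_local by (intro integrableI_bounded) (auto simp: local_holder_space_def)
  show "AE y in \<nu> n. (\<lambda>m. trunc m y) \<longlonglongrightarrow> f y"
  proof (rule AE_I2)
    fix y
    have "\<forall>\<^sub>F m in sequentially. trunc m y = f y"
      by (rule eventually_sequentiallyI[of "shd y"]) (simp add: trunc_def)
    then show "(\<lambda>m. trunc m y) \<longlonglongrightarrow> f y" by (rule tendsto_eventually)
  qed
qed (use f_measurable[OF f_local] in \<open>auto simp: trunc_def\<close>)

lemma normalized_op_close_integral:
  assumes x: "x \<in> X (n + Suc j)"
  shows "\<bar>P n (Suc j) f x - (\<integral>y. f y \<partial>\<nu> n)\<bar> \<le> rate ^ j * ((\<kappa> + c) / c * lip_factor * R n f)"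
    (is "_ \<le> ?T")
proof -
  have "\<forall>k. \<exists>z. z \<in> X (n + k)" using shift_space_nonempty W_nonempty by blast
  then obtain z where z: "\<And>k. z k \<in> X (n + k)" by metis
  have "0 \<le> ?T"
    using rate_pos kappa_nonneg c_pos lip_factor_pos R_nonneg[OF f_local]
    by (intro mult_nonneg_nonneg) auto
  then have osc: "\<bar>P n (Suc j) f x - P n (Suc j) f y\<bar> \<le> ?T" if "y \<in> X (n + Suc j)" for y
    using normalized_op_lipschitz[OF x that] mult_left_le[of "d x y" ?T] by simp
  \<comment> \<open>The oscillation at step \<open>Suc j\<close> confines all later iterates, by the
    maximum principle.\<close>
  have "\<bar>P n (Suc j) f x - P n k f (z k)\<bar> \<le> ?T" if "k \<ge> Suc j" for k
  proof -
    have "P n (Suc j) f x - ?T \<le> P n (Suc j + (k - Suc j)) f (z k)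
        \<and> P n (Suc j + (k - Suc j)) f (z k) \<le> P n (Suc j) f x + ?T"
    proof (rule normalized_op_bounds)
      show "P n (Suc j) f x - ?T \<le> P n (Suc j) f y" if "y \<in> X (n + Suc j)" for y
        using osc[OF that] by linarith
      show "P n (Suc j) f y \<le> P n (Suc j) f x + ?T" if "y \<in> X (n + Suc j)" for y
        using osc[OF that] by linarith
    qed (use z[of k] that in simp)
    then show ?thesis using that by (simp add: abs_le_iff)
  qed
  moreover have "\<bar>P n k f (z k) - P n k (trunc m) (z k)\<bar> \<le> exp (2 * L) * tail m" if "k \<ge> Suc j" for k m
    using normalized_op_trunc_close[of "z k" "k - 1" m] z[of k] that by simp
  ultimately have bound: "\<bar>P n (Suc j) f x - P n k (trunc m) (z k)\<bar> \<le> ?T + exp (2 * L) * tail m"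
    if "k \<ge> Suc j" for k m
    using that abs_triangle_ineq4 by (smt (verit, best))
  \<comment> \<open>First k tends to infinity with m fixed, where the limit is known because
    \<open>trunc m\<close> is Hoelder; then m does. The order is possible because the truncation
    error is uniform in k.\<close>
  have "\<bar>P n (Suc j) f x - (\<integral>y. trunc m y \<partial>\<nu> n)\<bar> \<le> ?T + exp (2 * L) * tail m" for m
  proof (rule LIMSEQ_le_const2)
    show "(\<lambda>k. \<bar>P n (Suc j) f x - P n k (trunc m) (z k)\<bar>) \<longlonglongrightarrow> \<bar>P n (Suc j) f x - (\<integral>y. trunc m y \<partial>\<nu> n)\<bar>"
      by (intro tendsto_intros limit_nu_holder trunc_in_holder_space z)
  qed (use bound in blast)
  moreover have "(\<lambda>m. \<bar>P n (Suc j) f x - (\<integral>y. trunc m y \<partial>\<nu> n)\<bar>)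
      \<longlonglongrightarrow> \<bar>P n (Suc j) f x - (\<integral>y. f y \<partial>\<nu> n)\<bar>"
    by (intro tendsto_intros integral_trunc_tendsto)
  moreover have "(\<lambda>m. ?T + exp (2 * L) * tail m) \<longlonglongrightarrow> ?T + exp (2 * L) * 0"
    by (intro tendsto_intros tail_tendsto)
  ultimately have "\<bar>P n (Suc j) f x - (\<integral>y. f y \<partial>\<nu> n)\<bar> \<le> ?T + exp (2 * L) * 0"
    by (intro LIMSEQ_le) auto
  then show ?thesis by simp
qed

end

text \<open>The division by \<open>rate\<close> turns \<open>rate ^ j\<close> into
  \<open>rate ^ k\<close> for k = Suc j.\<close>

definition decay_const :: real where
  "decay_const = (\<kappa> + c) / c * lip_factor / rate"

lemma decay_const_pos: "0 < decay_const"
  using kappa_nonneg c_pos lip_factor_pos rate_pos by (simp add: decay_const_def add_nonneg_pos)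

text \<open>Every \<open>C\<close> from \<open>decay_const\<close> on is allowed, which leaves room
  to choose a constant above 1.\<close>

lemma local_holder_norm_bounds:
  assumes f: "f \<in> local_holder_space r W \<nu> n" and k: "k \<ge> 1" and C: "decay_const \<le> C"
  shows "lip_const r W (n + k) (P n k f) \<le> ennreal (C * rate ^ k) * local_holder_norm r W \<nu> n f"
    and "sup_norm W (n + k) (\<lambda>x. P n k f x - (\<integral>y. f y \<partial>\<nu> n))
      \<le> ennreal (C * rate ^ k) * local_holder_norm r W \<nu> n f"
proof -
  obtain j where j: "k = Suc j" using k by (cases k) auto
  let ?T = "C * rate ^ k * R n f"
  have "rate ^ j * ((\<kappa> + c) / c * lip_factor * R n f) = decay_const * (rate ^ k * R n f)"
    using rate_pos by (simp add: decay_const_def j)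
  also have "\<dots> \<le> C * (rate ^ k * R n f)"
    using C rate_pos R_nonneg[OF f] by (intro mult_right_mono) auto
  finally have T: "rate ^ j * ((\<kappa> + c) / c * lip_factor * R n f) \<le> ?T" by (simp add: mult.assoc)
  have N: "ennreal ?T = ennreal (C * rate ^ k) * local_holder_norm r W \<nu> n f"
    using C decay_const_pos rate_pos R_nonneg[OF f]
    by (simp add: local_holder_norm_eq_R[OF f] ennreal_mult)
  have "lip_const r W (n + k) (P n k f) \<le> ennreal ?T"
    unfolding lip_const_def
  proof (intro Sup_least, clarify, rule ennreal_leI)
    fix x y assume x: "x \<in> X (n + k)" and y: "y \<in> X (n + k)" and "x \<noteq> y"
    then have "0 < d x y" using r_pos by (simp add: shift_dist_pos)
    have "\<bar>P n k f x - P n k f y\<bar> \<le> rate ^ j * ((\<kappa> + c) / c * lip_factor * R n f) * d x y"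
      using normalized_op_lipschitz[OF f] x y unfolding j by blast
    also have "\<dots> \<le> ?T * d x y" using T by (rule mult_right_mono) simp
    finally show "\<bar>P n k f x - P n k f y\<bar> / d x y \<le> ?T"
      using \<open>0 < d x y\<close> by (simp add: field_simps)
  qed
  then show "lip_const r W (n + k) (P n k f) \<le> ennreal (C * rate ^ k) * local_holder_norm r W \<nu> n f"
    by (simp only: N)
  have "sup_norm W (n + k) (\<lambda>x. P n k f x - (\<integral>y. f y \<partial>\<nu> n)) \<le> ennreal ?T"
    unfolding sup_norm_def
  proof (intro SUP_least ennreal_leI)
    fix x assume "x \<in> X (n + k)"
    then show "\<bar>P n k f x - (\<integral>y. f y \<partial>\<nu> n)\<bar> \<le> ?T"
      using normalized_op_close_integral[OF f, of x j] T unfolding j by linarith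
  qed
  then show "sup_norm W (n + k) (\<lambda>x. P n k f x - (\<integral>y. f y \<partial>\<nu> n))
      \<le> ennreal (C * rate ^ k) * local_holder_norm r W \<nu> n f"
    by (simp only: N)
qed

end

theorem theorem2p2:
  fixes W :: "nat \<Rightarrow> nat set"
    and \<phi> :: "nat \<Rightarrow> nat stream \<Rightarrow> real"
    and r :: real
    and \<nu> :: "nat \<Rightarrow> nat stream measure"
  assumes "\<And>n. W n \<noteq> {}" and "\<And>n. W n \<subseteq> {1..}"
    and "\<And>n x. x \<in> shift_space W n \<Longrightarrow> \<phi> n x > 0"
    and "0 < r" and "r < 1"
    and "(SUP n. holder_const r W n (\<lambda>x. ln (\<phi> n x))) < \<infinity>"
    and "\<And>n x. x \<in> shift_space W (Suc n) \<Longrightarrow> (\<lambda>a. \<phi> n (a ## x)) summable_on W n"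
    and "\<And>n. sup_norm W (Suc n) (transfer_op W \<phi> n (\<lambda>_. 1)) < \<infinity>"
    and "limit_measures r W \<phi> \<nu>"
  shows "\<exists>C s :: real. C > 1 \<and> 0 < s \<and> s < 1 \<and>
    (\<forall>n. \<forall>f \<in> local_holder_space r W \<nu> n. \<forall>k \<ge> 1.
       lip_const r W (n + k) (normalized_op W \<phi> n k f)
         \<le> ennreal (C * s ^ k) * local_holder_norm r W \<nu> n f \<and>
       sup_norm W (n + k) (\<lambda>x. normalized_op W \<phi> n k f x - (\<integral>y. f y \<partial>\<nu> n))
         \<le> ennreal (C * s ^ k) * local_holder_norm r W \<nu> n f)"
proof -
  let ?l = "\<lambda>n x. ln (\<phi> n x)"
  have pos: "0 < \<phi> n x" if "x \<in> shift_space W n" for n x by (rule assms(3)[OF that])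
  obtain M where M: "0 \<le> M" "(SUP n. holder_const r W n (?l n)) = ennreal M"
    using assms(6) by (metis ennreal_cases infinity_ennreal_def less_irrefl)
  have ratio: "\<phi> n (a ## x) \<le> exp (M * r * shift_dist r x y) * \<phi> n (a ## y)"
    if "a \<in> W n" "x \<in> shift_space W (Suc n)" "y \<in> shift_space W (Suc n)" for n a x y
  proof -
    have "holder_const r W n (?l n) \<le> ennreal M"
      unfolding M(2)[symmetric] by (rule SUP_upper) simp
    \<comment> \<open>Both points begin with \<open>a\<close>, so the cylinderwise constant applies;
      prepending \<open>a\<close> provides the factor \<open>r\<close>.\<close>
    then have "\<bar>?l n (a ## x) - ?l n (a ## y)\<bar> \<le> M * shift_dist r (a ## x) (a ## y)"
      using that assms(4) M(1) by (intro holder_const_bound) auto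
    then have "?l n (a ## x) \<le> M * r * shift_dist r x y + ?l n (a ## y)" by simp
    then have "exp (?l n (a ## x)) \<le> exp (M * r * shift_dist r x y + ?l n (a ## y))" by simp
    then show ?thesis using that pos[of "a ## x" n] pos[of "a ## y" n] by (simp add: exp_add)
  qed
  interpret holder_shift_measures W \<phi> r M \<nu>
    by unfold_locales (fact assms(1) pos assms(4) assms(5) M(1) ratio assms(7) assms(9))+
  \<comment> \<open>Adding 1 to the positive \<open>decay_const\<close> makes the constant exceed
    1.\<close>
  show ?thesis
    using local_holder_norm_bounds[where C = "decay_const + 1"] decay_const_pos rate_pos rate_less_1
    by (intro exI[of _ "decay_const + 1"] exI[of _ rate]) auto
qed

end
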